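(* Let $d\ge1$ and let $\phi_1,\ldots,\phi_{d+1}$ be integrable (real- or complex-valued) functions on $\mathbb{R}$. For $x_{d+1}\in\mathbb{R}$ let $$I(x_{d+1})=\int_{-\infty<x_1<\cdots<x_d<\infty}\det\bigl(\phi_i(x_j)\bigr)_{1\le i,j\le d+1}\,dx_1\cdots dx_d.$$ Let $A=(a_{ij})_{1\le i,j\le d+1}$, $b=(b_1,\ldots,b_{d+1})^\top$, $p(x_{d+1})=(\phi_1(x_{d+1}),\ldots,\phi_{d+1}(x_{d+1}))^\top$ with $$a_{ij}=\int_{-\infty<x<y<\infty}\det\begin{pmatrix}\phi_i(x)&\phi_i(y)\\\phi_j(x)&\phi_j(y)\end{pmatrix}dx\,dy,\qquad b_i=\int_{-\infty}^\infty\phi_i(x)\,dx.$$ Then $$I(x_{d+1})=(-1)^d\times\begin{cases}\mathrm{pf}\begin{pmatrix}A&p(x_{d+1})\\-p(x_{d+1})^\top&0\end{pmatrix}&(d\text{ even}),\\[3ex]\mathrm{pf}\begin{pmatrix}A&b&p(x_{d+1})\\-b^\top&0&1\\-p(x_{d+1})^\top&-1&0\end{pmatrix}-\mathrm{pf}(A)&(d\text{ odd}).\end{cases}$$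
   Context: For a skew-symmetric $n\times n$ matrix $A=(a_{ij})$ with $n$ even, $\mathrm{pf}(A)=\sum_\pi\mathrm{sgn}(\pi)a_{\pi(1)\pi(2)}\cdots a_{\pi(n-1)\pi(n)}$, the sum being over permutations $\pi$ of $\{1,\dots,n\}$ with $\pi(2k-1)<\pi(2k)$ for all $k$ and $\pi(1)<\pi(3)<\cdots<\pi(n-1)$. The variable $x_{d+1}$ is not integrated over and is not constrained by the ordering. *)

theory Defs
  imports "HOL-Analysis.Analysis" "Jordan_Normal_Form.Determinant"
begin

text \<open>All indices start at 0: the functions are \<open>\<phi> 0, \<dots>, \<phi> d\<close>, the integration variables
  are \<open>x 0, \<dots>, x (d - 1)\<close>, and the free variable is the one with index \<open>d\<close>.
  Qualified names select the matrices and vectors of \<open>Jordan_Normal_Form\<close>, whose dimensions are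
  numbers, over those of \<open>HOL-Analysis\<close>. Scalars range over the sort
  \<open>{real_normed_field, banach, second_countable_topology}\<close>, which contains both \<open>real\<close> and
  \<open>complex\<close>.\<close>

text \<open>The sum over perfect matchings. With indices starting at 0 the conditions
  \<open>\<pi> (2k - 1) < \<pi> (2k)\<close> and \<open>\<pi> 1 < \<pi> 3 < \<dots>\<close> are shifted by one. The definition is meant for
  skew-symmetric matrices of even dimension.\<close>

definition pfaffian :: "'a::comm_ring_1 mat \<Rightarrow> 'a" where
  "pfaffian M =
    (\<Sum>\<pi> | \<pi> permutes {0..<dim_row M}
          \<and> (\<forall>k. 2 * k + 1 < dim_row M \<longrightarrow> \<pi> (2 * k) < \<pi> (2 * k + 1))
          \<and> (\<forall>k. 2 * k + 2 < dim_row M \<longrightarrow> \<pi> (2 * k) < \<pi> (2 * k + 2)).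
       of_int (sign \<pi>) * (\<Prod>k<dim_row M div 2. M $$ (\<pi> (2 * k), \<pi> (2 * k + 1))))"

text \<open>Lebesgue measure on the space of \<open>d\<close>-tuples. The completion makes it the Lebesgue measure
  proper, and not just its restriction to the product sigma-algebra.\<close>

definition lebesgue_tuples :: "nat \<Rightarrow> (nat \<Rightarrow> real) measure" where
  "lebesgue_tuples d = completion (\<Pi>\<^sub>M i\<in>{..<d}. lborel)"

text \<open>The update \<open>x(d := t)\<close> puts the free variable behind the \<open>d\<close> integration variables; the
  ordering concerns the latter only.\<close>

definition ordered_det_integral ::
  "nat \<Rightarrow> (nat \<Rightarrow> real \<Rightarrow> 'a::{real_normed_field, banach, second_countable_topology}) \<Rightarrow> real \<Rightarrow> 'a"
where
  "ordered_det_integral d \<phi> t =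
    (LINT x:{x. strict_mono_on {..<d} x}|lebesgue_tuples d.
       Determinant.det (Matrix.mat (d + 1) (d + 1) (\<lambda>(i, j). \<phi> i ((x(d := t)) j))))"

definition pair_integral_mat ::
  "nat \<Rightarrow> (nat \<Rightarrow> real \<Rightarrow> 'a::{real_normed_field, banach, second_countable_topology}) \<Rightarrow> 'a mat"
where
  "pair_integral_mat d \<phi> = Matrix.mat (d + 1) (d + 1) (\<lambda>(i, j).
     set_lebesgue_integral lebesgue {(x :: real, y :: real). x < y}
       (\<lambda>(x, y). Determinant.det (mat_of_rows_list 2 [[\<phi> i x, \<phi> i y], [\<phi> j x, \<phi> j y]])))"

definition integral_vec ::
  "nat \<Rightarrow> (nat \<Rightarrow> real \<Rightarrow> 'a::{real_normed_field, banach, second_countable_topology}) \<Rightarrow> 'a Matrix.vec"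
where
  "integral_vec d \<phi> = Matrix.vec (d + 1) (\<lambda>i. LINT x|lebesgue. \<phi> i x)"

definition value_vec :: "nat \<Rightarrow> (nat \<Rightarrow> real \<Rightarrow> 'a) \<Rightarrow> real \<Rightarrow> 'a Matrix.vec" where
  "value_vec d \<phi> t = Matrix.vec (d + 1) (\<lambda>i. \<phi> i t)"

end

theory Submission
  imports Defs
begin

text \<open>This is de Bruijn's Pfaffian evaluation of an integral over ordered tuples, with one additional
column at the free variable. The proof replaces the sum over perfect matchings in the Pfaffian by a
sum over all permutations, where symmetry arguments become changes of summation index.

\<^bold>\<open>Symmetrization.\<close> The signed product of the entries of a skew-symmetric matrix over the pairs
\<open>(\<sigma> (2k), \<sigma> (2k + 1))\<close> does not change when \<open>\<sigma>\<close> is composed on the right with a permutation of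
positions that maps pairs to pairs. These permutations form the hyperoctahedral group, and the
permutations that index the Pfaffian are representatives of its left cosets. Hence the sum over all
permutations is the order of the group times the Pfaffian
(\<open>sum_permutations_eq_card_mult_matchings\<close>). The group permutes the positions transitively, so a
prescribed value may be assumed to stand at the last position. This gives the expansions
\<open>matching_sum_expand_last\<close> and \<open>matching_sum_expand_two_last\<close> of a bordered Pfaffian; in the
second one the term \<open>pfaffian A\<close> arises from the matchings that pair the two border indices.

\<^bold>\<open>Integration.\<close> The entry \<open>(i, j)\<close> of the matrix is the integral over the plane of
\<open>\<phi>\<^sub>i(x) \<phi>\<^sub>j(y)\<close> times the sign of \<open>y - x\<close>. By Fubini the expanded Pfaffian is therefore an
integral over all \<open>d\<close>-tuples: of the determinant times the product of the signs of
\<open>x\<^sub>2\<^sub>k\<^sub>+\<^sub>1 - x\<^sub>2\<^sub>k\<close>. The determinant is alternating, so it vanishes unless the coordinates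
are distinct, and then exactly one permutation sorts them. Sorting moves everything to the ordered
region and leaves there the determinant times the constant \<open>\<Sum>\<^sub>\<tau> sgn \<tau> \<Prod>\<^sub>k sgn (\<tau> (2k + 1) - \<tau> (2k))\<close>.

\<^bold>\<open>The constant.\<close> If two values \<open>2k\<close> and \<open>2k + 1\<close> do not stand at paired positions, exchanging
them reverses \<open>sgn \<tau>\<close> and changes no comparison inside a pair. These terms cancel; the others
are the elements of the hyperoctahedral group and contribute \<open>1\<close> each
(\<open>sum_matching_term_order_sign\<close>). So the constant is the order of the group, which cancels
against the factor from the symmetrization.\<close>

section \<open>Permutations that respect the pairing of positions\<close>

text \<open>The pairs are \<open>{2k, 2k + 1}\<close>, so the partner of a position is found by flipping its last bit.\<close>

definition mate :: "nat \<Rightarrow> nat" where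
  "mate i = (if even i then Suc i else i - 1)"

lemma mate_double [simp]: "mate (2 * k) = Suc (2 * k)" "mate (Suc (2 * k)) = 2 * k"
  by (simp_all add: mate_def)

lemma nat_parity_cases:
  fixes i :: nat
  obtains k where "i = 2 * k" | k where "i = Suc (2 * k)"
  by (metis evenE oddE Suc_eq_plus1)

lemma mate_mate [simp]: "mate (mate i) = i"
  by (cases i rule: nat_parity_cases) simp_all

lemma mate_neq [simp]: "mate i \<noteq> i"
  by (cases i rule: nat_parity_cases) simp_all

lemma mate_div_2 [simp]: "mate i div 2 = i div 2"
  by (cases i rule: nat_parity_cases) simp_all

lemma div_2_eq_iff_mate: "i div 2 = j div 2 \<longleftrightarrow> i = j \<or> i = mate j"
  by (cases i rule: nat_parity_cases; cases j rule: nat_parity_cases) auto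

text \<open>Being compatible with the pairing is expressed as commuting with the involution \<open>mate\<close>; closure
under composition and inverses is then immediate. For odd \<open>n\<close> the last position is fixed, since
its partner lies outside of the permuted set.\<close>

definition hyperoctahedral :: "nat \<Rightarrow> (nat \<Rightarrow> nat) set" where
  "hyperoctahedral n = {h. h permutes {..<n} \<and> (\<forall>i. h (mate i) = mate (h i))}"

lemma hyperoctahedralD:
  assumes "h \<in> hyperoctahedral n"
  shows "h permutes {..<n}" and "h (mate i) = mate (h i)"
  using assms by (auto simp: hyperoctahedral_def)

lemma hyperoctahedral_id: "id \<in> hyperoctahedral n"
  by (simp add: hyperoctahedral_def)

lemma hyperoctahedral_comp:
  "g \<in> hyperoctahedral n \<Longrightarrow> h \<in> hyperoctahedral n \<Longrightarrow> g \<circ> h \<in> hyperoctahedral n"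
  by (auto simp: hyperoctahedral_def intro: permutes_compose)

lemma hyperoctahedral_inv:
  assumes "h \<in> hyperoctahedral n"
  shows "Hilbert_Choice.inv h \<in> hyperoctahedral n"
proof -
  note h = hyperoctahedralD[OF assms]
  have "Hilbert_Choice.inv h (mate i) = mate (Hilbert_Choice.inv h i)" for i
    by (metis h permutes_inverses(1) permutes_inverses(2))
  with h(1) show ?thesis
    by (simp add: hyperoctahedral_def permutes_inv)
qed

lemma finite_hyperoctahedral: "finite (hyperoctahedral n)"
  by (rule finite_subset[OF _ finite_permutations[of "{..<n}"]]) (auto simp: hyperoctahedral_def)

lemma card_hyperoctahedral_pos: "0 < card (hyperoctahedral n)"
  using finite_hyperoctahedral hyperoctahedral_id by (auto simp: card_gt_0_iff)

definition pair_flip :: "nat \<Rightarrow> nat \<Rightarrow> nat" where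
  "pair_flip k = Transposition.transpose (2 * k) (Suc (2 * k))"

definition pair_swap :: "nat \<Rightarrow> nat \<Rightarrow> nat \<Rightarrow> nat" where
  "pair_swap k l = Transposition.transpose (2 * k) (2 * l) \<circ> Transposition.transpose (Suc (2 * k)) (Suc (2 * l))"

lemma pair_swap_apply:
  "pair_swap k l (2 * j) = 2 * Transposition.transpose k l j"
  "pair_swap k l (Suc (2 * j)) = Suc (2 * Transposition.transpose k l j)"
  unfolding pair_swap_def by (auto simp: Transposition.transpose_def)

lemma pair_flip_apply:
  "pair_flip k (2 * j) = (if j = k then Suc (2 * j) else 2 * j)"
  "pair_flip k (Suc (2 * j)) = (if j = k then 2 * j else Suc (2 * j))"
  unfolding pair_flip_def by (auto simp: Transposition.transpose_def)

lemma pair_flip_in_hyperoctahedral: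
  assumes "k < m"
  shows "pair_flip k \<in> hyperoctahedral (2 * m)"
proof -
  have "pair_flip k (mate i) = mate (pair_flip k i)" for i
    by (cases i rule: nat_parity_cases) (auto simp: pair_flip_apply)
  moreover have "pair_flip k permutes {..<2 * m}"
    unfolding pair_flip_def using assms by (intro permutes_swap_id) auto
  ultimately show ?thesis
    by (simp add: hyperoctahedral_def)
qed

lemma pair_swap_in_hyperoctahedral:
  assumes "k < m" "l < m"
  shows "pair_swap k l \<in> hyperoctahedral (2 * m)"
proof -
  have "pair_swap k l (mate i) = mate (pair_swap k l i)" for i
    by (cases i rule: nat_parity_cases) (auto simp: pair_swap_apply)
  moreover have "pair_swap k l permutes {..<2 * m}"
    unfolding pair_swap_def using assms by (intro permutes_compose permutes_swap_id) auto
  ultimately show ?thesis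
    by (simp add: hyperoctahedral_def)
qed

lemma pair_flip_involution: "pair_flip k \<circ> (pair_flip k \<circ> h) = h"
  by (simp add: pair_flip_def fun_eq_iff)

lemma pair_swap_involution: "pair_swap k l \<circ> (pair_swap k l \<circ> h) = h"
proof -
  have "pair_swap k l (pair_swap k l i) = i" for i
    by (cases i rule: nat_parity_cases) (auto simp: pair_swap_apply)
  then show ?thesis by (simp add: fun_eq_iff)
qed

lemma hyperoctahedral_fix_last:
  assumes h: "h \<in> hyperoctahedral (2 * Suc m)" and fix_last: "h (Suc (2 * m)) = Suc (2 * m)"
  shows "h \<in> hyperoctahedral (2 * m)"
proof -
  have "h (2 * m) = 2 * m"
    using hyperoctahedralD(2)[OF h, of "Suc (2 * m)"] fix_last by simp
  with fix_last have "h i = i" if "i \<in> {..<2 * Suc m} - {..<2 * m}" for i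
  proof -
    have "i = 2 * m \<or> i = Suc (2 * m)"
      using that by simp linarith
    with fix_last \<open>h (2 * m) = 2 * m\<close> show ?thesis by metis
  qed
  then have "h permutes {..<2 * m}"
    by (rule permutes_superset[OF hyperoctahedralD(1)[OF h]])
  with h show ?thesis
    by (simp add: hyperoctahedral_def)
qed

text \<open>Generation of the hyperoctahedral group by flips of one pair and exchanges of two pairs. A flip and
an exchange suffice to move the image of the last position back to its place; its partner then
returns as well, and what remains is an element of the group on one pair fewer.\<close>

lemma hyperoctahedral_induct [consumes 1, case_names id flip swap]:
  assumes h: "h \<in> hyperoctahedral (2 * m)"
    and P_id: "P id"
    and P_flip: "\<And>k h. k < m \<Longrightarrow> P h \<Longrightarrow> P (pair_flip k \<circ> h)"
    and P_swap: "\<And>k l h. k < m \<Longrightarrow> l < m \<Longrightarrow> P h \<Longrightarrow> P (pair_swap k l \<circ> h)"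
  shows "P h"
proof -
  have "P h" if "n \<le> m" "h \<in> hyperoctahedral (2 * n)" for n h
    using that
  proof (induction n arbitrary: h)
    case 0
    then show ?case
      using hyperoctahedralD(1)[OF 0(2)] P_id by (simp add: id_def)
  next
    case (Suc n)
    have odd_image: "P g" if g: "g \<in> hyperoctahedral (2 * Suc n)"
      and l: "g (Suc (2 * n)) = Suc (2 * l)" "l \<le> n" for g l
    proof -
      have "pair_swap l n \<circ> g \<in> hyperoctahedral (2 * Suc n)"
        using l(2) by (intro hyperoctahedral_comp pair_swap_in_hyperoctahedral g) auto
      then have "pair_swap l n \<circ> g \<in> hyperoctahedral (2 * n)"
        by (rule hyperoctahedral_fix_last) (simp add: l(1) pair_swap_apply)
      then have "P (pair_swap l n \<circ> g)"
        using Suc.IH Suc.prems(1) by simp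
      then have "P (pair_swap l n \<circ> (pair_swap l n \<circ> g))"
        using l(2) Suc.prems(1) by (intro P_swap[of l n "pair_swap l n \<circ> g"]) simp_all
      then show "P g"
        by (simp only: pair_swap_involution)
    qed
    have bound: "h (Suc (2 * n)) < 2 * Suc n"
      using permutes_in_image[OF hyperoctahedralD(1)[OF Suc.prems(2)], of "Suc (2 * n)"] by simp
    show ?case
    proof (cases "h (Suc (2 * n))" rule: nat_parity_cases)
      case (1 l)
      have "pair_flip l \<circ> h \<in> hyperoctahedral (2 * Suc n)"
        using 1 bound by (intro hyperoctahedral_comp pair_flip_in_hyperoctahedral Suc.prems(2)) auto
      then have "P (pair_flip l \<circ> h)"
        by (rule odd_image[of _ l]) (use 1 bound in \<open>auto simp: pair_flip_apply\<close>)
      then have "P (pair_flip l \<circ> (pair_flip l \<circ> h))"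
        using 1 bound Suc.prems(1) by (intro P_flip[of l "pair_flip l \<circ> h"]) simp_all
      then show ?thesis
        by (simp only: pair_flip_involution)
    next
      case (2 l)
      then show ?thesis
        using bound odd_image[OF Suc.prems(2), of l] by simp
    qed
  qed
  with h show ?thesis by blast
qed

section \<open>Signed products over pairs\<close>

definition matching_term :: "(nat \<Rightarrow> nat \<Rightarrow> 'a::comm_ring_1) \<Rightarrow> nat \<Rightarrow> (nat \<Rightarrow> nat) \<Rightarrow> 'a" where
  "matching_term M n \<sigma> = of_int (sign \<sigma>) * (\<Prod>k<n div 2. M (\<sigma> (2 * k)) (\<sigma> (Suc (2 * k))))"

lemma hyperoctahedral_permutation: "h \<in> hyperoctahedral n \<Longrightarrow> permutation h"
  by (rule permutes_imp_permutation[OF finite_lessThan hyperoctahedralD(1)])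

lemma matching_term_flip:
  assumes skew: "\<And>i j. M i j = - M j i" and \<sigma>: "permutation \<sigma>" and k: "k < m"
  shows "matching_term M (2 * m) (\<sigma> \<circ> pair_flip k) = matching_term M (2 * m) \<sigma>"
proof -
  have "sign (\<sigma> \<circ> pair_flip k) = - sign \<sigma>"
    using \<sigma> by (simp add: sign_compose pair_flip_def sign_swap_id permutation_swap_id)
  moreover have "(\<Prod>j<m. M (\<sigma> (pair_flip k (2 * j))) (\<sigma> (pair_flip k (Suc (2 * j)))))
      = (\<Prod>j<m. (if j = k then -1 else 1) * M (\<sigma> (2 * j)) (\<sigma> (Suc (2 * j))))"
    using skew[of "\<sigma> (Suc (2 * k))" "\<sigma> (2 * k)"]
    by (intro prod.cong refl) (simp add: pair_flip_apply)
  moreover have "\<dots> = - (\<Prod>j<m. M (\<sigma> (2 * j)) (\<sigma> (Suc (2 * j))))"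
    using k by (simp add: prod.distrib)
  ultimately show ?thesis
    by (simp add: matching_term_def)
qed

lemma matching_term_swap:
  assumes \<sigma>: "permutation \<sigma>" and k: "k < m" "l < m"
  shows "matching_term M (2 * m) (\<sigma> \<circ> pair_swap k l) = matching_term M (2 * m) \<sigma>"
proof -
  have "sign (pair_swap k l) = 1"
    by (simp add: pair_swap_def sign_compose sign_swap_id permutation_swap_id)
  then have "sign (\<sigma> \<circ> pair_swap k l) = sign \<sigma>"
    using \<sigma> k by (simp add: sign_compose hyperoctahedral_permutation[OF pair_swap_in_hyperoctahedral])
  moreover have "(\<Prod>j<m. M (\<sigma> (pair_swap k l (2 * j))) (\<sigma> (pair_swap k l (Suc (2 * j)))))
      = (\<Prod>j<m. M (\<sigma> (2 * j)) (\<sigma> (Suc (2 * j))))"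
    using k prod.permute[OF permutes_swap_id[of k "{..<m}" l],
        of "\<lambda>j. M (\<sigma> (2 * j)) (\<sigma> (Suc (2 * j)))"]
    by (simp add: pair_swap_apply comp_def)
  ultimately show ?thesis
    by (simp add: matching_term_def)
qed

text \<open>It suffices to treat the generators: a flip reverses the sign of the permutation and of one factor,
while an exchange of pairs is a product of two transpositions and only reorders the factors.\<close>

lemma matching_term_hyperoctahedral:
  assumes skew: "\<And>i j. M i j = - M j i" and \<sigma>: "permutation \<sigma>"
    and h: "h \<in> hyperoctahedral (2 * m)"
  shows "matching_term M (2 * m) (\<sigma> \<circ> h) = matching_term M (2 * m) \<sigma>"
proof -
  have "\<forall>\<sigma>. permutation \<sigma> \<longrightarrow> matching_term M (2 * m) (\<sigma> \<circ> h) = matching_term M (2 * m) \<sigma>"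
    using h
  proof (induction rule: hyperoctahedral_induct)
    case (flip k h)
    show ?case
    proof (intro allI impI)
      fix \<sigma> :: "nat \<Rightarrow> nat" assume \<sigma>: "permutation \<sigma>"
      then have "permutation (\<sigma> \<circ> pair_flip k)"
        using hyperoctahedral_permutation[OF pair_flip_in_hyperoctahedral[OF flip.hyps]]
        by (rule permutation_compose)
      then have "matching_term M (2 * m) ((\<sigma> \<circ> pair_flip k) \<circ> h) = matching_term M (2 * m) (\<sigma> \<circ> pair_flip k)"
        using flip.IH by blast
      also have "\<dots> = matching_term M (2 * m) \<sigma>"
        by (rule matching_term_flip[where M = M, OF skew \<sigma> flip.hyps])
      finally show "matching_term M (2 * m) (\<sigma> \<circ> (pair_flip k \<circ> h)) = matching_term M (2 * m) \<sigma>"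
        by (simp only: comp_assoc)
    qed
  next
    case (swap k l h)
    show ?case
    proof (intro allI impI)
      fix \<sigma> :: "nat \<Rightarrow> nat" assume \<sigma>: "permutation \<sigma>"
      then have "permutation (\<sigma> \<circ> pair_swap k l)"
        using hyperoctahedral_permutation[OF pair_swap_in_hyperoctahedral[OF swap.hyps]]
        by (rule permutation_compose)
      then have "matching_term M (2 * m) ((\<sigma> \<circ> pair_swap k l) \<circ> h) = matching_term M (2 * m) (\<sigma> \<circ> pair_swap k l)"
        using swap.IH by blast
      also have "\<dots> = matching_term M (2 * m) \<sigma>"
        by (rule matching_term_swap[where M = M, OF \<sigma> swap.hyps])
      finally show "matching_term M (2 * m) (\<sigma> \<circ> (pair_swap k l \<circ> h)) = matching_term M (2 * m) \<sigma>"
        by (simp only: comp_assoc)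
    qed
  qed simp
  with \<sigma> show ?thesis by blast
qed

section \<open>Sorting permutations\<close>

lemma bounded_strict_mono_on_id:
  fixes f :: "nat \<Rightarrow> nat"
  assumes mono: "strict_mono_on {..<n} f" and bound: "\<And>k. k < n \<Longrightarrow> f k < n" and k: "k < n"
  shows "f k = k"
proof -
  have shift: "f i + j \<le> f (i + j)" if "i + j < n" for i j
    using that
  proof (induction j)
    case (Suc j)
    then have "f (i + j) < f (i + Suc j)"
      by (intro strict_mono_onD[OF mono]) auto
    with Suc show ?case by simp
  qed simp
  have "f k + (n - 1 - k) \<le> f (n - 1)"
    using shift[of k "n - 1 - k"] k by simp
  moreover have "f (n - 1) < n"
    using bound k by simp
  moreover have "k \<le> f k"
    using shift[of 0 k] k by simp
  ultimately show ?thesis using k by linarith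
qed

lemma sorting_permutation_unique:
  fixes x :: "nat \<Rightarrow> 'a::linorder"
  assumes \<sigma>: "\<sigma> permutes {..<n}" "strict_mono_on {..<n} (x \<circ> \<sigma>)"
    and \<tau>: "\<tau> permutes {..<n}" "strict_mono_on {..<n} (x \<circ> \<tau>)"
  shows "\<sigma> = \<tau>"
proof -
  define g where "g = Hilbert_Choice.inv \<sigma> \<circ> \<tau>"
  have g: "g permutes {..<n}"
    unfolding g_def using \<sigma>(1) \<tau>(1) by (intro permutes_compose permutes_inv)
  have \<tau>_eq: "\<tau> = \<sigma> \<circ> g"
    unfolding g_def using permutes_inverses(1)[OF \<sigma>(1)] by (simp add: fun_eq_iff)
  have "strict_mono_on {..<n} g"
  proof (rule strict_mono_onI)
    fix i j assume ij: "i \<in> {..<n}" "j \<in> {..<n}" "i < j"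
    then have "x (\<sigma> (g i)) < x (\<sigma> (g j))"
      using strict_mono_onD[OF \<tau>(2)] unfolding \<tau>_eq by (simp add: comp_def)
    then show "g i < g j"
      using strict_mono_on_less[OF \<sigma>(2), of "g i" "g j"] ij permutes_in_image[OF g]
      by (simp add: comp_def)
  qed
  then have "g k = k" for k
    using bounded_strict_mono_on_id[of n g k] g permutes_in_image[OF g] permutes_not_in[OF g, of k]
    by (cases "k < n") auto
  then show ?thesis
    by (simp add: \<tau>_eq fun_eq_iff)
qed

lemma sorting_permutation_exists:
  fixes x :: "nat \<Rightarrow> 'a::linorder"
  assumes inj: "inj_on x {..<n}"
  obtains \<tau> where "\<tau> permutes {..<n}" and "strict_mono_on {..<n} (x \<circ> \<tau>)"
proof -
  define xs where "xs = sorted_list_of_set (x ` {..<n})"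
  have len: "length xs = n"
    by (simp add: xs_def card_image[OF inj])
  have set_xs: "set xs = x ` {..<n}"
    by (simp add: xs_def)
  have bij: "bij_betw (nth xs) {..<n} (x ` {..<n})"
    by (rule bij_betw_nth) (simp_all only: len set_xs, simp add: xs_def)
  have bij_x: "bij_betw x {..<n} (x ` {..<n})"
    using inj by (rule inj_on_imp_bij_betw)
  define \<tau> where "\<tau> k = (if k < n then inv_into {..<n} x (xs ! k) else k)" for k
  have "bij_betw (inv_into {..<n} x \<circ> nth xs) {..<n} {..<n}"
    using bij bij_betw_inv_into[OF bij_x] by (rule bij_betw_trans)
  then have "bij_betw \<tau> {..<n} {..<n}"
    by (rule bij_betw_cong[THEN iffD1, rotated]) (simp add: \<tau>_def)
  then have "\<tau> permutes {..<n}"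
    by (rule bij_imp_permutes) (simp add: \<tau>_def)
  moreover have x\<tau>: "x (\<tau> k) = xs ! k" if "k < n" for k
  proof -
    have "xs ! k \<in> x ` {..<n}"
      using that len set_xs nth_mem by metis
    with that show ?thesis
      by (simp add: \<tau>_def f_inv_into_f)
  qed
  have "strict_mono_on {..<n} (x \<circ> \<tau>)"
    using sorted_wrt_nth_less[OF strict_sorted_list_of_set[of "x ` {..<n}"]] len
    by (intro strict_mono_onI) (simp add: x\<tau> xs_def[symmetric])
  ultimately show ?thesis
    using that by blast
qed

section \<open>Matchings as coset representatives\<close>

definition matching_perms :: "nat \<Rightarrow> (nat \<Rightarrow> nat) set" where
  "matching_perms n = {\<pi>. \<pi> permutes {..<n}
     \<and> (\<forall>k. Suc (2 * k) < n \<longrightarrow> \<pi> (2 * k) < \<pi> (Suc (2 * k)))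
     \<and> (\<forall>k. 2 * k + 2 < n \<longrightarrow> \<pi> (2 * k) < \<pi> (2 * k + 2))}"

lemma matching_perms_heads_mono:
  assumes "\<pi> \<in> matching_perms (2 * m)"
  shows "strict_mono_on {..<m} (\<lambda>k. \<pi> (2 * k))"
proof (rule strict_mono_onI)
  fix i j assume "i \<in> {..<m}" "j \<in> {..<m}" "i < j"
  have step: "\<pi> (2 * k) < \<pi> (2 * Suc k)" if "Suc k < m" for k
    using assms that by (simp add: matching_perms_def)
  have "Suc (i + d) < m \<Longrightarrow> \<pi> (2 * i) < \<pi> (2 * Suc (i + d))" for d
  proof (induction d)
    case 0
    then show ?case using step[of i] by simp
  next
    case (Suc d)
    then show ?case using step[of "Suc (i + d)"] by simp
  qed
  then show "\<pi> (2 * i) < \<pi> (2 * j)"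
    using \<open>i < j\<close> \<open>j \<in> {..<m}\<close> less_imp_Suc_add[of i j] by auto
qed

text \<open>Two representatives of the same coset coincide. The order inside the pairs forbids \<open>g\<close> to exchange
partners, and the increasing smaller elements forbid it to move pairs.\<close>

lemma matching_perms_unique:
  assumes \<pi>: "\<pi> \<in> matching_perms (2 * m)" and \<pi>g: "\<pi> \<circ> g \<in> matching_perms (2 * m)"
    and g: "g \<in> hyperoctahedral (2 * m)"
  shows "g = id"
proof -
  note perm_g = hyperoctahedralD(1)[OF g]
  have g_bound: "g i < 2 * m" if "i < 2 * m" for i
    using permutes_in_image[OF perm_g, of i] that by simp
  have even_g: "even (g (2 * k))" if "k < m" for k
  proof (rule ccontr)
    assume "\<not> even (g (2 * k))"
    then obtain q where q: "g (2 * k) = Suc (2 * q)"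
      by (metis oddE Suc_eq_plus1)
    then have "g (Suc (2 * k)) = 2 * q"
      using hyperoctahedralD(2)[OF g, of "2 * k"] by simp
    moreover have "q < m"
      using g_bound[of "2 * k"] q that by simp
    moreover have "\<pi> (g (2 * k)) < \<pi> (g (Suc (2 * k)))"
      using \<pi>g that by (simp add: matching_perms_def)
    moreover have "\<pi> (2 * q) < \<pi> (Suc (2 * q))" if "q < m"
      using \<pi> that by (simp add: matching_perms_def)
    ultimately show False using q by simp
  qed
  define \<gamma> where "\<gamma> k = g (2 * k) div 2" for k
  have \<gamma>: "g (2 * k) = 2 * \<gamma> k" if "k < m" for k
    using even_g[OF that] by (simp add: \<gamma>_def)
  have \<gamma>_bound: "\<gamma> k < m" if "k < m" for k
    using g_bound[of "2 * k"] \<gamma>[OF that] that by simp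
  have "strict_mono_on {..<m} \<gamma>"
  proof (rule strict_mono_onI)
    fix i j assume ij: "i \<in> {..<m}" "j \<in> {..<m}" "i < j"
    then have "\<pi> (2 * \<gamma> i) < \<pi> (2 * \<gamma> j)"
      using strict_mono_onD[OF matching_perms_heads_mono[OF \<pi>g] ij] \<gamma> by simp
    then show "\<gamma> i < \<gamma> j"
      using strict_mono_on_less[OF matching_perms_heads_mono[OF \<pi>], of "\<gamma> i" "\<gamma> j"] ij \<gamma>_bound
      by simp
  qed
  then have "\<gamma> k = k" if "k < m" for k
    using bounded_strict_mono_on_id \<gamma>_bound that by blast
  with \<gamma> have even_fix: "g (2 * k) = 2 * k" if "k < m" for k
    using that by simp
  have "g i = i" for i
  proof (cases "i < 2 * m")
    case True
    then show ?thesis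
      using even_fix hyperoctahedralD(2)[OF g, of "2 * (i div 2)"]
      by (cases i rule: nat_parity_cases) auto
  next
    case False
    then show ?thesis using permutes_not_in[OF perm_g] by simp
  qed
  then show ?thesis by (simp add: fun_eq_iff)
qed

text \<open>Every coset is represented: choose the position of the smaller value in each pair, and sort the pairs
by these values.\<close>

lemma matching_perms_exists:
  assumes \<sigma>: "\<sigma> permutes {..<2 * m}"
  obtains h where "h \<in> hyperoctahedral (2 * m)" and "\<sigma> \<circ> h \<in> matching_perms (2 * m)"
proof -
  define q where "q k = (if \<sigma> (2 * k) < \<sigma> (Suc (2 * k)) then 2 * k else Suc (2 * k))" for k
  have q_div: "q k div 2 = k" for k
    by (simp add: q_def)
  have q_less: "\<sigma> (q k) < \<sigma> (mate (q k))" for k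
  proof -
    have "\<sigma> (2 * k) \<noteq> \<sigma> (Suc (2 * k))"
      using permutes_inj[OF \<sigma>] by (metis injD n_not_Suc_n)
    then show ?thesis by (simp add: q_def)
  qed
  have "inj_on (\<sigma> \<circ> q) {..<m}"
    by (rule inj_onI) (metis comp_apply injD permutes_inj[OF \<sigma>] q_div)
  then obtain \<gamma> where \<gamma>: "\<gamma> permutes {..<m}" and mono: "strict_mono_on {..<m} (\<sigma> \<circ> q \<circ> \<gamma>)"
    by (rule sorting_permutation_exists)
  \<comment> \<open>The pair \<open>k\<close> is sent to the pair \<open>\<gamma> k\<close>, oriented such that the smaller value comes first.\<close>
  define h where "h i = (if even i then q (\<gamma> (i div 2)) else mate (q (\<gamma> (i div 2))))" for i
  have h_div: "h i div 2 = \<gamma> (i div 2)" for i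
    by (simp add: h_def q_div)
  have h_mate: "h (mate i) = mate (h i)" for i
    by (cases i rule: nat_parity_cases) (simp_all add: h_def)
  have "h permutes {..<2 * m}"
  proof (rule bij_imp_permutes)
    have "inj_on h {..<2 * m}"
    proof (rule inj_onI)
      fix i j assume eq: "h i = h j"
      then have "\<gamma> (i div 2) = \<gamma> (j div 2)"
        by (metis h_div)
      then have "i = j \<or> i = mate j"
        using permutes_inj[OF \<gamma>] div_2_eq_iff_mate by (auto dest: injD)
      then show "i = j"
        using eq h_mate mate_neq by metis
    qed
    moreover have "h ` {..<2 * m} \<subseteq> {..<2 * m}"
    proof (rule image_subsetI)
      fix i assume "i \<in> {..<2 * m}"
      then have "h i div 2 < m"
        using permutes_in_image[OF \<gamma>, of "i div 2"] by (simp add: h_div)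
      then show "h i \<in> {..<2 * m}" by simp
    qed
    ultimately show "bij_betw h {..<2 * m} {..<2 * m}"
      by (simp add: bij_betw_def endo_inj_surj)
  next
    fix i assume "i \<notin> {..<2 * m}"
    then have *: "\<gamma> (i div 2) = i div 2"
      using permutes_not_in[OF \<gamma>, of "i div 2"] by simp
    \<comment> \<open>Outside of the range \<open>\<sigma>\<close> is the identity, so \<open>q k\<close> selects the even position.\<close>
    have "\<sigma> (2 * (i div 2)) = 2 * (i div 2)" "\<sigma> (Suc (2 * (i div 2))) = Suc (2 * (i div 2))"
      using \<open>i \<notin> {..<2 * m}\<close> by (auto intro!: permutes_not_in[OF \<sigma>])
    then show "h i = i"
      unfolding h_def * q_def by (cases i rule: nat_parity_cases) auto
  qed
  then have h: "h \<in> hyperoctahedral (2 * m)"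
    using h_mate by (simp add: hyperoctahedral_def)
  have "\<sigma> (h (2 * k)) < \<sigma> (h (Suc (2 * k)))" for k
    using q_less by (simp add: h_def)
  moreover have "\<sigma> (h (2 * k)) < \<sigma> (h (2 * k + 2))" if "2 * k + 2 < 2 * m" for k
    using strict_mono_onD[OF mono, of k "Suc k"] that by (simp add: h_def)
  moreover have "\<sigma> \<circ> h permutes {..<2 * m}"
    using \<sigma> hyperoctahedralD(1)[OF h] by (intro permutes_compose)
  ultimately have "\<sigma> \<circ> h \<in> matching_perms (2 * m)"
    by (simp add: matching_perms_def)
  with h that show ?thesis by blast
qed

lemma bij_betw_matching_perms_hyperoctahedral:
  "bij_betw (\<lambda>(\<pi>, h). \<pi> \<circ> h) (matching_perms (2 * m) \<times> hyperoctahedral (2 * m))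
     {\<sigma>. \<sigma> permutes {..<2 * m}}"
proof (rule bij_betwI')
  fix a b
  assume a: "a \<in> matching_perms (2 * m) \<times> hyperoctahedral (2 * m)"
    and b: "b \<in> matching_perms (2 * m) \<times> hyperoctahedral (2 * m)"
  obtain \<pi> h \<rho> g where ab: "a = (\<pi>, h)" "b = (\<rho>, g)"
    by (cases a; cases b)
  have mem: "\<pi> \<in> matching_perms (2 * m)" "h \<in> hyperoctahedral (2 * m)"
      "\<rho> \<in> matching_perms (2 * m)" "g \<in> hyperoctahedral (2 * m)"
    using a b ab by auto
  have "\<pi> = \<rho> \<and> h = g" if eq: "\<pi> \<circ> h = \<rho> \<circ> g"
  proof -
    \<comment> \<open>The element of the group that relates the two representatives.\<close>
    define u where "u = h \<circ> Hilbert_Choice.inv g"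
    have u: "u \<in> hyperoctahedral (2 * m)"
      unfolding u_def using mem by (intro hyperoctahedral_comp hyperoctahedral_inv)
    have "\<rho> = \<rho> \<circ> (g \<circ> Hilbert_Choice.inv g)"
      using permutes_inv_o(1)[OF hyperoctahedralD(1)[OF mem(4)]] by simp
    also have "\<dots> = \<pi> \<circ> u"
      using eq by (simp add: u_def comp_assoc[symmetric])
    finally have \<rho>: "\<rho> = \<pi> \<circ> u" .
    then have "u = id"
      using matching_perms_unique[OF mem(1) _ u] mem(3) by simp
    moreover have "h = u \<circ> g"
      using permutes_inv_o(2)[OF hyperoctahedralD(1)[OF mem(4)]] by (simp add: u_def comp_assoc)
    ultimately show ?thesis using \<rho> by simp
  qed
  then show "((case a of (\<pi>, h) \<Rightarrow> \<pi> \<circ> h) = (case b of (\<pi>, h) \<Rightarrow> \<pi> \<circ> h)) = (a = b)"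
    by (auto simp: ab)
next
  fix a assume "a \<in> matching_perms (2 * m) \<times> hyperoctahedral (2 * m)"
  then show "(case a of (\<pi>, h) \<Rightarrow> \<pi> \<circ> h) \<in> {\<sigma>. \<sigma> permutes {..<2 * m}}"
    by (auto simp: matching_perms_def hyperoctahedral_def intro: permutes_compose)
next
  fix \<sigma> assume "\<sigma> \<in> {\<sigma>. \<sigma> permutes {..<2 * m}}"
  then obtain h where h: "h \<in> hyperoctahedral (2 * m)" "\<sigma> \<circ> h \<in> matching_perms (2 * m)"
    using matching_perms_exists by blast
  have "\<sigma> = (\<sigma> \<circ> h) \<circ> Hilbert_Choice.inv h"
    using permutes_inv_o(1)[OF hyperoctahedralD(1)[OF h(1)]] by (simp add: comp_assoc)
  then show "\<exists>a\<in>matching_perms (2 * m) \<times> hyperoctahedral (2 * m). \<sigma> = (case a of (\<pi>, h) \<Rightarrow> \<pi> \<circ> h)"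
    using h by (intro bexI[of _ "(\<sigma> \<circ> h, Hilbert_Choice.inv h)"]) (auto intro: hyperoctahedral_inv)
qed

lemma sum_permutations_eq_card_mult_matchings:
  fixes M :: "nat \<Rightarrow> nat \<Rightarrow> 'a::comm_ring_1"
  assumes skew: "\<And>i j. M i j = - M j i"
  shows "(\<Sum>\<sigma> | \<sigma> permutes {..<2 * m}. matching_term M (2 * m) \<sigma>)
    = of_nat (card (hyperoctahedral (2 * m))) * (\<Sum>\<pi>\<in>matching_perms (2 * m). matching_term M (2 * m) \<pi>)"
proof -
  have "(\<Sum>\<sigma> | \<sigma> permutes {..<2 * m}. matching_term M (2 * m) \<sigma>)
      = (\<Sum>(\<pi>, h)\<in>matching_perms (2 * m) \<times> hyperoctahedral (2 * m). matching_term M (2 * m) (\<pi> \<circ> h))"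
    using sum.reindex_bij_betw[OF bij_betw_matching_perms_hyperoctahedral[of m],
        of "matching_term M (2 * m)"]
    by (simp add: case_prod_unfold)
  also have "\<dots> = (\<Sum>(\<pi>, h)\<in>matching_perms (2 * m) \<times> hyperoctahedral (2 * m). matching_term M (2 * m) \<pi>)"
  proof (rule sum.cong[OF refl], clarify)
    fix \<pi> h assume "\<pi> \<in> matching_perms (2 * m)" and h: "h \<in> hyperoctahedral (2 * m)"
    then have "permutation \<pi>"
      by (auto simp: matching_perms_def intro: permutes_imp_permutation)
    then show "matching_term M (2 * m) (\<pi> \<circ> h) = matching_term M (2 * m) \<pi>"
      by (rule matching_term_hyperoctahedral[where M = M, OF skew _ h])
  qed
  also have "\<dots> = of_nat (card (hyperoctahedral (2 * m))) * (\<Sum>\<pi>\<in>matching_perms (2 * m). matching_term M (2 * m) \<pi>)"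
    by (simp add: sum.cartesian_product[symmetric] sum_distrib_left)
  finally show ?thesis .
qed

section \<open>Moving a value to the last position\<close>

lemma hyperoctahedral_transitive:
  assumes j: "j < 2 * Suc m"
  obtains t where "t \<in> hyperoctahedral (2 * Suc m)" and "t (Suc (2 * m)) = j"
proof (cases j rule: nat_parity_cases)
  case (1 l)
  with j have "pair_flip l \<circ> pair_swap l m \<in> hyperoctahedral (2 * Suc m)"
    by (intro hyperoctahedral_comp pair_flip_in_hyperoctahedral pair_swap_in_hyperoctahedral)
      simp_all
  moreover have "(pair_flip l \<circ> pair_swap l m) (Suc (2 * m)) = j"
    using 1 by (simp add: pair_swap_apply pair_flip_apply)
  ultimately show ?thesis using that by blast
next
  case (2 l)
  with j have "pair_swap l m \<in> hyperoctahedral (2 * Suc m)"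
    by (intro pair_swap_in_hyperoctahedral) simp_all
  moreover have "pair_swap l m (Suc (2 * m)) = j"
    using 2 by (simp add: pair_swap_apply)
  ultimately show ?thesis using that by blast
qed

text \<open>Splitting the sum by the position of the value \<open>v\<close> gives \<open>2 * Suc m\<close> parts. They are equal, because
by transitivity a group element carries any position to the last one. This is used for
permutations, for the group itself, and for a subset of the permutations.\<close>

lemma sum_eq_mult_sum_last_position:
  fixes g :: "(nat \<Rightarrow> nat) \<Rightarrow> 'b::semiring_1"
  assumes fin: "finite X" and inj: "\<And>\<sigma>. \<sigma> \<in> X \<Longrightarrow> inj \<sigma>"
    and closed: "\<And>\<sigma> h. \<sigma> \<in> X \<Longrightarrow> h \<in> hyperoctahedral (2 * Suc m) \<Longrightarrow> \<sigma> \<circ> h \<in> X"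
    and invariant: "\<And>\<sigma> h. \<sigma> \<in> X \<Longrightarrow> h \<in> hyperoctahedral (2 * Suc m) \<Longrightarrow> g (\<sigma> \<circ> h) = g \<sigma>"
    and attained: "\<And>\<sigma>. \<sigma> \<in> X \<Longrightarrow> \<exists>j<2 * Suc m. \<sigma> j = v"
  shows "(\<Sum>\<sigma>\<in>X. g \<sigma>) = of_nat (2 * Suc m) * (\<Sum>\<sigma> | \<sigma> \<in> X \<and> \<sigma> (Suc (2 * m)) = v. g \<sigma>)"
proof -
  have "g \<sigma> = (\<Sum>j<2 * Suc m. if \<sigma> j = v then g \<sigma> else 0)" if \<sigma>: "\<sigma> \<in> X" for \<sigma>
  proof -
    obtain j where j: "j < 2 * Suc m" "\<sigma> j = v"
      using attained[OF \<sigma>] by blast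
    then have "\<sigma> i = v \<longleftrightarrow> i = j" for i
      using injD[OF inj[OF \<sigma>]] by blast
    with j show ?thesis by simp
  qed
  then have "(\<Sum>\<sigma>\<in>X. g \<sigma>) = (\<Sum>\<sigma>\<in>X. \<Sum>j<2 * Suc m. if \<sigma> j = v then g \<sigma> else 0)"
    by (rule sum.cong[OF refl])
  also have "\<dots> = (\<Sum>j<2 * Suc m. \<Sum>\<sigma>\<in>X. if \<sigma> j = v then g \<sigma> else 0)"
    by (rule sum.swap)
  also have "\<dots> = (\<Sum>j<2 * Suc m. \<Sum>\<sigma> | \<sigma> \<in> X \<and> \<sigma> j = v. g \<sigma>)"
    using fin by (simp add: sum.inter_filter)
  also have "\<dots> = (\<Sum>j<2 * Suc m. \<Sum>\<sigma> | \<sigma> \<in> X \<and> \<sigma> (Suc (2 * m)) = v. g \<sigma>)"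
  proof (rule sum.cong[OF refl])
    fix j assume "j \<in> {..<2 * Suc m}"
    then obtain t where t: "t \<in> hyperoctahedral (2 * Suc m)" "t (Suc (2 * m)) = j"
      using hyperoctahedral_transitive[of j m] by blast
    have inv_t: "Hilbert_Choice.inv t \<in> hyperoctahedral (2 * Suc m)"
      using t(1) by (rule hyperoctahedral_inv)
    have inv_tj: "Hilbert_Choice.inv t j = Suc (2 * m)"
      using permutes_inv_eq[OF hyperoctahedralD(1)[OF t(1)]] t(2) by blast
    show "(\<Sum>\<sigma> | \<sigma> \<in> X \<and> \<sigma> j = v. g \<sigma>) = (\<Sum>\<sigma> | \<sigma> \<in> X \<and> \<sigma> (Suc (2 * m)) = v. g \<sigma>)"
    proof (rule sum.reindex_bij_witness[of _ "\<lambda>\<sigma>. \<sigma> \<circ> Hilbert_Choice.inv t" "\<lambda>\<sigma>. \<sigma> \<circ> t"])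
      fix \<sigma> assume "\<sigma> \<in> {\<sigma> \<in> X. \<sigma> j = v}"
      then show "\<sigma> \<circ> t \<in> {\<sigma> \<in> X. \<sigma> (Suc (2 * m)) = v}" "g (\<sigma> \<circ> t) = g \<sigma>"
        "\<sigma> \<circ> t \<circ> Hilbert_Choice.inv t = \<sigma>"
        using closed invariant t permutes_inv_o(1)[OF hyperoctahedralD(1)[OF t(1)]]
        by (simp_all add: comp_assoc)
    next
      fix \<sigma> assume "\<sigma> \<in> {\<sigma> \<in> X. \<sigma> (Suc (2 * m)) = v}"
      then show "\<sigma> \<circ> Hilbert_Choice.inv t \<in> {\<sigma> \<in> X. \<sigma> j = v}"
        "\<sigma> \<circ> Hilbert_Choice.inv t \<circ> t = \<sigma>"
        using closed inv_t inv_tj permutes_inv_o(2)[OF hyperoctahedralD(1)[OF t(1)]]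
        by (simp_all add: comp_assoc)
    qed
  qed
  also have "\<dots> = of_nat (2 * Suc m) * (\<Sum>\<sigma> | \<sigma> \<in> X \<and> \<sigma> (Suc (2 * m)) = v. g \<sigma>)"
    by (simp only: sum_constant card_lessThan)
  finally show ?thesis .
qed

text \<open>Orbit counting: the stabilizer of the last position is the group on one pair fewer.\<close>

lemma card_hyperoctahedral_Suc:
  "card (hyperoctahedral (2 * Suc m)) = 2 * Suc m * card (hyperoctahedral (2 * m))"
proof -
  have "{h \<in> hyperoctahedral (2 * Suc m). h (Suc (2 * m)) = Suc (2 * m)} = hyperoctahedral (2 * m)"
  proof (intro equalityI subsetI)
    fix h assume "h \<in> hyperoctahedral (2 * m)"
    then show "h \<in> {h \<in> hyperoctahedral (2 * Suc m). h (Suc (2 * m)) = Suc (2 * m)}"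
      by (auto simp: hyperoctahedral_def permutes_not_in intro: permutes_subset)
  qed (auto intro: hyperoctahedral_fix_last)
  moreover have "(\<Sum>h\<in>hyperoctahedral (2 * Suc m). 1 :: nat) = of_nat (2 * Suc m) *
      (\<Sum>h | h \<in> hyperoctahedral (2 * Suc m) \<and> h (Suc (2 * m)) = Suc (2 * m). 1)"
  proof (rule sum_eq_mult_sum_last_position)
    fix h assume h: "h \<in> hyperoctahedral (2 * Suc m)"
    note perm = hyperoctahedralD(1)[OF h]
    show "inj h"
      using perm by (rule permutes_inj)
    have "Suc (2 * m) \<in> h ` {..<2 * Suc m}"
      using permutes_image[OF perm] by simp
    then show "\<exists>j<2 * Suc m. h j = Suc (2 * m)"
      by auto
  qed (auto intro: finite_hyperoctahedral hyperoctahedral_comp)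
  ultimately show ?thesis
    by simp
qed

lemma permutes_lessThan_fix_last:
  "{\<sigma>. \<sigma> permutes {..<Suc n} \<and> \<sigma> n = n} = {\<sigma>. \<sigma> permutes {..<n}}"
proof (intro equalityI subsetI)
  fix \<sigma> assume "\<sigma> \<in> {\<sigma>. \<sigma> permutes {..<Suc n} \<and> \<sigma> n = n}"
  then show "\<sigma> \<in> {\<sigma>. \<sigma> permutes {..<n}}"
    by (auto intro: permutes_superset[of \<sigma> "{..<Suc n}"] simp: less_Suc_eq)
next
  fix \<sigma> assume "\<sigma> \<in> {\<sigma>. \<sigma> permutes {..<n}}"
  then show "\<sigma> \<in> {\<sigma>. \<sigma> permutes {..<Suc n} \<and> \<sigma> n = n}"
    by (auto intro: permutes_subset simp: permutes_not_in)
qed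

lemma matching_term_Suc:
  "matching_term M (2 * Suc m) \<sigma> = matching_term M (2 * m) \<sigma> * M (\<sigma> (2 * m)) (\<sigma> (Suc (2 * m)))"
  by (simp add: matching_term_def mult.assoc)

lemma sum_matching_term_last:
  fixes M :: "nat \<Rightarrow> nat \<Rightarrow> 'a::comm_ring_1"
  assumes skew: "\<And>i j. M i j = - M j i"
  shows "(\<Sum>\<sigma> | \<sigma> permutes {..<2 * Suc m}. matching_term M (2 * Suc m) \<sigma>)
    = of_nat (2 * Suc m) *
      (\<Sum>\<sigma> | \<sigma> permutes {..<Suc (2 * m)}. matching_term M (2 * m) \<sigma> * M (\<sigma> (2 * m)) (Suc (2 * m)))"
proof -
  let ?X = "{\<sigma>. \<sigma> permutes {..<2 * Suc m}}"
  have "(\<Sum>\<sigma>\<in>?X. matching_term M (2 * Suc m) \<sigma>) = of_nat (2 * Suc m) *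
      (\<Sum>\<sigma> | \<sigma> \<in> ?X \<and> \<sigma> (Suc (2 * m)) = Suc (2 * m). matching_term M (2 * Suc m) \<sigma>)"
  proof (rule sum_eq_mult_sum_last_position)
    fix \<sigma> assume \<sigma>: "\<sigma> \<in> ?X"
    show "inj \<sigma>"
      using \<sigma> permutes_inj by blast
    have "Suc (2 * m) \<in> \<sigma> ` {..<2 * Suc m}"
      using \<sigma> permutes_image[of \<sigma>] by simp
    then show "\<exists>j<2 * Suc m. \<sigma> j = Suc (2 * m)"
      by auto
    fix h assume h: "h \<in> hyperoctahedral (2 * Suc m)"
    show "\<sigma> \<circ> h \<in> ?X"
      using \<sigma> hyperoctahedralD(1)[OF h] by (simp add: permutes_compose)
    have "permutation \<sigma>"
      using \<sigma> by (auto intro: permutes_imp_permutation)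
    then show "matching_term M (2 * Suc m) (\<sigma> \<circ> h) = matching_term M (2 * Suc m) \<sigma>"
      by (rule matching_term_hyperoctahedral[where M = M, OF skew _ h])
  qed (simp add: finite_permutations)
  also have "{\<sigma>. \<sigma> \<in> ?X \<and> \<sigma> (Suc (2 * m)) = Suc (2 * m)} = {\<sigma>. \<sigma> permutes {..<Suc (2 * m)}}"
    using permutes_lessThan_fix_last[of "Suc (2 * m)"] by simp
  also have "(\<Sum>\<sigma> | \<sigma> permutes {..<Suc (2 * m)}. matching_term M (2 * Suc m) \<sigma>)
      = (\<Sum>\<sigma> | \<sigma> permutes {..<Suc (2 * m)}. matching_term M (2 * m) \<sigma> * M (\<sigma> (2 * m)) (Suc (2 * m)))"
    by (rule sum.cong[OF refl]) (simp only: matching_term_Suc, simp add: permutes_not_in)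
  finally show ?thesis .
qed

section \<open>The signed count of permutations\<close>

definition order_sign :: "'b::linorder \<Rightarrow> 'b \<Rightarrow> 'a::ring_1" where
  "order_sign x y = (if x < y then 1 else if y < x then - 1 else 0)"

lemma order_sign_skew: "order_sign x y = - order_sign y x"
  by (auto simp: order_sign_def)

lemma order_sign_strict_mono:
  assumes "strict_mono_on A f" "i \<in> A" "j \<in> A"
  shows "order_sign (f i) (f j) = order_sign i j"
  using strict_mono_on_less[OF assms] strict_mono_on_less[OF assms(1,3,2)]
  by (simp add: order_sign_def)

text \<open>Exchanging the adjacent numbers \<open>2k\<close> and \<open>2k + 1\<close> affects no comparison except the one between them.\<close>

lemma order_sign_pair_flip:
  assumes "\<not> (a = 2 * k \<and> b = Suc (2 * k))" "\<not> (a = Suc (2 * k) \<and> b = 2 * k)"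
  shows "order_sign (pair_flip k a) (pair_flip k b) = order_sign a b"
  using assms unfolding order_sign_def pair_flip_def Transposition.transpose_def
  by auto

text \<open>The indices of the value pairs that \<open>\<tau>\<close> does not put at paired positions; the group consists of the
permutations without such pairs.\<close>

definition split_values :: "nat \<Rightarrow> (nat \<Rightarrow> nat) \<Rightarrow> nat set" where
  "split_values m \<tau> =
    {k. k < m \<and> Hilbert_Choice.inv \<tau> (Suc (2 * k)) \<noteq> mate (Hilbert_Choice.inv \<tau> (2 * k))}"

lemma hyperoctahedral_iff_split_values:
  assumes \<tau>: "\<tau> permutes {..<2 * m}"
  shows "\<tau> \<in> hyperoctahedral (2 * m) \<longleftrightarrow> split_values m \<tau> = {}"
proof
  assume "\<tau> \<in> hyperoctahedral (2 * m)"
  then show "split_values m \<tau> = {}"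
    using hyperoctahedralD(2)[OF hyperoctahedral_inv, of \<tau> "2 * m"]
    by (force simp: split_values_def simp flip: mate_double(1))
next
  assume empty: "split_values m \<tau> = {}"
  let ?\<rho> = "Hilbert_Choice.inv \<tau>"
  have \<rho>: "?\<rho> permutes {..<2 * m}"
    using \<tau> by (rule permutes_inv)
  have odd_eq: "?\<rho> (Suc (2 * k)) = mate (?\<rho> (2 * k))" for k
  proof (cases "k < m")
    case True
    then show ?thesis using empty by (auto simp: split_values_def)
  next
    case False
    then have "?\<rho> (2 * k) = 2 * k" "?\<rho> (Suc (2 * k)) = Suc (2 * k)"
      by (auto intro!: permutes_not_in[OF \<rho>])
    then show ?thesis by simp
  qed
  have "?\<rho> (mate i) = mate (?\<rho> i)" for i
    by (cases i rule: nat_parity_cases) (simp_all add: odd_eq)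
  with \<rho> have "?\<rho> \<in> hyperoctahedral (2 * m)"
    by (simp add: hyperoctahedral_def)
  then show "\<tau> \<in> hyperoctahedral (2 * m)"
    using hyperoctahedral_inv[of ?\<rho>] permutes_inv_inv[OF \<tau>] by metis
qed

lemma split_values_pair_flip:
  assumes \<tau>: "\<tau> permutes {..<2 * m}" and k: "k < m"
  shows "split_values m (pair_flip k \<circ> \<tau>) = split_values m \<tau>"
proof -
  have "Hilbert_Choice.inv (pair_flip k \<circ> \<tau>) = Hilbert_Choice.inv \<tau> \<circ> pair_flip k"
    using o_inv_distrib[OF _ permutes_bij[OF \<tau>], of "pair_flip k"]
      permutes_bij[OF hyperoctahedralD(1)[OF pair_flip_in_hyperoctahedral[OF k]]]
    by (simp add: pair_flip_def)
  moreover have "x \<noteq> mate y \<longleftrightarrow> y \<noteq> mate x" for x y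
    by (metis mate_mate)
  ultimately show ?thesis
    by (auto simp: split_values_def pair_flip_apply)
qed

lemma matching_term_order_sign_pair_flip:
  assumes \<tau>: "\<tau> permutes {..<2 * m}" and k: "k \<in> split_values m \<tau>"
  shows "matching_term order_sign (2 * m) (pair_flip k \<circ> \<tau>)
    = - (matching_term order_sign (2 * m) \<tau> :: 'a::comm_ring_1)"
proof -
  have "sign (pair_flip k \<circ> \<tau>) = - sign \<tau>"
    using permutes_imp_permutation[OF _ \<tau>]
    by (simp add: sign_compose pair_flip_def sign_swap_id permutation_swap_id)
  moreover have "(\<Prod>j<m. order_sign (pair_flip k (\<tau> (2 * j))) (pair_flip k (\<tau> (Suc (2 * j)))))
      = (\<Prod>j<m. order_sign (\<tau> (2 * j)) (\<tau> (Suc (2 * j))) :: 'a)"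
  proof (rule prod.cong[OF refl], rule order_sign_pair_flip)
    fix j
    have inv_eq: "Hilbert_Choice.inv \<tau> a = b \<longleftrightarrow> a = \<tau> b" for a b
      using permutes_inv_eq[OF \<tau>] by metis
    have split: "Hilbert_Choice.inv \<tau> (Suc (2 * k)) \<noteq> mate (Hilbert_Choice.inv \<tau> (2 * k))"
      using k by (simp add: split_values_def)
    show "\<not> (\<tau> (2 * j) = 2 * k \<and> \<tau> (Suc (2 * j)) = Suc (2 * k))"
      using split inv_eq by (metis mate_double(1))
    show "\<not> (\<tau> (2 * j) = Suc (2 * k) \<and> \<tau> (Suc (2 * j)) = 2 * k)"
      using split inv_eq by (metis mate_double(2))
  qed
  ultimately show ?thesis
    by (simp add: matching_term_def)
qed

text \<open>Outside of the group, exchanging the first pair of values that stand at unpaired positions is a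
sign-reversing involution: it does not alter which pairs are split, so it finds the same pair again.\<close>

lemma sum_matching_term_order_sign_even:
  "(\<Sum>\<tau> | \<tau> permutes {..<2 * m}. matching_term order_sign (2 * m) \<tau>)
    = (of_nat (card (hyperoctahedral (2 * m))) :: 'a::field_char_0)"
proof -
  let ?f = "\<lambda>\<tau>. matching_term order_sign (2 * m) \<tau> :: 'a"
  define N where "N = {\<tau>. \<tau> permutes {..<2 * m}} - hyperoctahedral (2 * m)"
  define k where "k \<tau> = (LEAST k. k \<in> split_values m \<tau>)" for \<tau>
  have k: "k \<tau> \<in> split_values m \<tau>" "k \<tau> < m" if "\<tau> \<in> N" for \<tau>
  proof -
    have "\<exists>k. k \<in> split_values m \<tau>"
      using that hyperoctahedral_iff_split_values by (auto simp: N_def)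
    then show "k \<tau> \<in> split_values m \<tau>"
      unfolding k_def by (rule LeastI_ex)
    then show "k \<tau> < m"
      by (simp add: split_values_def)
  qed
  have N: "\<tau> permutes {..<2 * m}" if "\<tau> \<in> N" for \<tau>
    using that by (simp add: N_def)
  have k_flip: "k (pair_flip (k \<tau>) \<circ> \<tau>) = k \<tau>" if "\<tau> \<in> N" for \<tau>
    unfolding k_def using split_values_pair_flip[OF N[OF that] k(2)[OF that]] k_def by simp
  have flip_N: "pair_flip (k \<tau>) \<circ> \<tau> \<in> N" if "\<tau> \<in> N" for \<tau>
  proof -
    have "pair_flip (k \<tau>) \<circ> \<tau> permutes {..<2 * m}"
      using N[OF that] hyperoctahedralD(1)[OF pair_flip_in_hyperoctahedral[OF k(2)[OF that]]]
      by (rule permutes_compose)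
    then show ?thesis
      using split_values_pair_flip[OF N[OF that] k(2)[OF that]] k(1)[OF that]
        hyperoctahedral_iff_split_values by (auto simp: N_def)
  qed
  have "(\<Sum>\<tau>\<in>N. ?f \<tau>) = (\<Sum>\<tau>\<in>N. - ?f \<tau>)"
  proof (rule sum.reindex_bij_witness[of _ "\<lambda>\<tau>. pair_flip (k \<tau>) \<circ> \<tau>" "\<lambda>\<tau>. pair_flip (k \<tau>) \<circ> \<tau>"])
    fix \<tau> assume "\<tau> \<in> N"
    then show "pair_flip (k (pair_flip (k \<tau>) \<circ> \<tau>)) \<circ> (pair_flip (k \<tau>) \<circ> \<tau>) = \<tau>"
      by (simp only: k_flip pair_flip_involution)
    from \<open>\<tau> \<in> N\<close> show "- ?f (pair_flip (k \<tau>) \<circ> \<tau>) = ?f \<tau>"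
      using matching_term_order_sign_pair_flip[OF N k(1), of \<tau>, where 'a = 'a] by simp
  qed (simp_all only: k_flip pair_flip_involution flip_N)
  then have "2 * (\<Sum>\<tau>\<in>N. ?f \<tau>) = 0"
    by (simp add: sum_negf)
  then have N_zero: "(\<Sum>\<tau>\<in>N. ?f \<tau>) = 0"
    by simp
  have one: "?f h = 1" if "h \<in> hyperoctahedral (2 * m)" for h
  proof -
    have "?f (id \<circ> h) = ?f id"
      by (rule matching_term_hyperoctahedral[OF order_sign_skew _ that]) (simp add: permutation_id)
    also have "\<dots> = 1"
      by (simp add: matching_term_def order_sign_def)
    finally show ?thesis by simp
  qed
  have "hyperoctahedral (2 * m) \<subseteq> {\<tau>. \<tau> permutes {..<2 * m}}"
    by (auto dest: hyperoctahedralD(1))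
  then have "(\<Sum>\<tau> | \<tau> permutes {..<2 * m}. ?f \<tau>)
      = (\<Sum>\<tau>\<in>N. ?f \<tau>) + (\<Sum>\<tau>\<in>hyperoctahedral (2 * m). ?f \<tau>)"
    unfolding N_def by (rule sum.subset_diff) (simp add: finite_permutations)
  then show ?thesis
    by (simp add: N_zero one)
qed

text \<open>The odd case follows from the even one with one element more: with the largest value at the last
position, the additional factor is \<open>1\<close>, and \<open>2 * Suc m\<close> cancels on both sides.\<close>

lemma sum_matching_term_order_sign:
  "(\<Sum>\<tau> | \<tau> permutes {..<d}. matching_term order_sign d \<tau>)
    = (of_nat (card (hyperoctahedral (2 * (d div 2)))) :: 'a::field_char_0)"
proof (cases d rule: nat_parity_cases)
  case (1 m)
  then show ?thesis
    by (simp add: sum_matching_term_order_sign_even)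
next
  case (2 m)
  have "of_nat (2 * Suc m) * (\<Sum>\<tau> | \<tau> permutes {..<Suc (2 * m)}. matching_term order_sign (2 * m) \<tau>)
      = of_nat (2 * Suc m) * (\<Sum>\<tau> | \<tau> permutes {..<Suc (2 * m)}.
          matching_term order_sign (2 * m) \<tau> * (order_sign (\<tau> (2 * m)) (Suc (2 * m)) :: 'a))"
  proof (intro arg_cong2[where f = times] refl sum.cong)
    fix \<tau> assume "\<tau> \<in> {\<tau>. \<tau> permutes {..<Suc (2 * m)}}"
    then have "\<tau> (2 * m) < Suc (2 * m)"
      using permutes_in_image[of \<tau> "{..<Suc (2 * m)}" "2 * m"] by simp
    then show "(matching_term order_sign (2 * m) \<tau> :: 'a)
        = matching_term order_sign (2 * m) \<tau> * order_sign (\<tau> (2 * m)) (Suc (2 * m))"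
      by (simp add: order_sign_def)
  qed
  also have "\<dots> = (\<Sum>\<tau> | \<tau> permutes {..<2 * Suc m}. matching_term order_sign (2 * Suc m) \<tau>)"
    by (rule sum_matching_term_last[OF order_sign_skew, symmetric])
  also have "\<dots> = of_nat (2 * Suc m) * of_nat (card (hyperoctahedral (2 * m)))"
    by (simp only: sum_matching_term_order_sign_even card_hyperoctahedral_Suc of_nat_mult)
  finally have "(\<Sum>\<tau> | \<tau> permutes {..<Suc (2 * m)}. matching_term order_sign (2 * m) \<tau>)
      = (of_nat (card (hyperoctahedral (2 * m))) :: 'a)"
    by (subst (asm) mult_left_cancel) (simp_all del: of_nat_Suc add: of_nat_eq_0_iff)
  moreover have "matching_term order_sign (Suc (2 * m)) = (matching_term order_sign (2 * m) :: _ \<Rightarrow> 'a)"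
    by (simp add: matching_term_def fun_eq_iff)
  ultimately show ?thesis
    using 2 by simp
qed

section \<open>Expansion of bordered Pfaffians\<close>

text \<open>The Pfaffian of the matrix with entries \<open>M i j\<close> for \<open>i, j < n\<close>. Entries given by a function
allow submatrices to be taken by lowering \<open>n\<close>.\<close>

definition matching_sum :: "(nat \<Rightarrow> nat \<Rightarrow> 'a::comm_ring_1) \<Rightarrow> nat \<Rightarrow> 'a" where
  "matching_sum M n = (\<Sum>\<pi>\<in>matching_perms n. matching_term M n \<pi>)"

lemma matching_sum_expand_last:
  fixes M :: "nat \<Rightarrow> nat \<Rightarrow> 'a::field_char_0"
  assumes skew: "\<And>i j. M i j = - M j i"
  shows "of_nat (card (hyperoctahedral (2 * m))) * matching_sum M (2 * Suc m)
    = (\<Sum>\<sigma> | \<sigma> permutes {..<Suc (2 * m)}. matching_term M (2 * m) \<sigma> * M (\<sigma> (2 * m)) (Suc (2 * m)))"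
    (is "?lhs = ?rhs")
proof -
  have "of_nat (2 * Suc m) * ?lhs = of_nat (card (hyperoctahedral (2 * Suc m))) * matching_sum M (2 * Suc m)"
    by (simp only: card_hyperoctahedral_Suc of_nat_mult mult.assoc)
  also have "\<dots> = (\<Sum>\<sigma> | \<sigma> permutes {..<2 * Suc m}. matching_term M (2 * Suc m) \<sigma>)"
    unfolding matching_sum_def
    by (rule sum_permutations_eq_card_mult_matchings[where M = M, OF skew, symmetric])
  also have "\<dots> = of_nat (2 * Suc m) * ?rhs"
    by (rule sum_matching_term_last[where M = M, OF skew])
  finally show ?thesis
    by (subst (asm) mult_left_cancel) (simp_all del: of_nat_Suc add: of_nat_eq_0_iff)
qed

text \<open>In the expansion by the last index, the permutations with \<open>\<sigma> n = n\<close> pair the two border indices and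
yield the Pfaffian without border. In the others, \<open>n\<close> may be moved to the position \<open>2q + 1\<close>, the
partner of \<open>2q\<close>; the transposition that takes it from there out of the permuted range accounts
for the minus sign.\<close>

lemma matching_sum_expand_two_last:
  fixes M :: "nat \<Rightarrow> nat \<Rightarrow> 'a::field_char_0"
  assumes skew: "\<And>i j. M i j = - M j i"
    and n_def: "n = 2 * Suc q"
  shows "of_nat (card (hyperoctahedral (2 * q)))
      * (matching_sum M (2 * Suc (Suc q)) - M n (Suc n) * matching_sum M n)
    = - (\<Sum>\<sigma> | \<sigma> permutes {..<n}.
          matching_term M (2 * q) \<sigma> * M (\<sigma> (2 * q)) n * M (\<sigma> (Suc (2 * q))) (Suc n))"
proof -
  let ?c = "of_nat (card (hyperoctahedral n)) :: 'a"
  let ?g = "\<lambda>\<sigma>. matching_term M n \<sigma> * M (\<sigma> n) (Suc n)"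
  let ?R = "\<Sum>\<sigma> | \<sigma> permutes {..<n}. matching_term M (2 * q) \<sigma> * M (\<sigma> (2 * q)) n * M (\<sigma> (Suc (2 * q))) (Suc n)"
  define X where "X = {\<sigma>. \<sigma> permutes {..<Suc n} \<and> \<sigma> n \<noteq> n}"
  have "?c * matching_sum M (2 * Suc (Suc q)) = (\<Sum>\<sigma> | \<sigma> permutes {..<Suc n}. ?g \<sigma>)"
    unfolding n_def by (rule matching_sum_expand_last[where M = M, OF skew])
  also have "{\<sigma>. \<sigma> permutes {..<Suc n}} = {\<sigma>. \<sigma> permutes {..<Suc n} \<and> \<sigma> n = n} \<union> X"
    by (auto simp: X_def)
  also have "(\<Sum>\<sigma>\<in>\<dots>. ?g \<sigma>) = (\<Sum>\<sigma> | \<sigma> permutes {..<Suc n} \<and> \<sigma> n = n. ?g \<sigma>) + (\<Sum>\<sigma>\<in>X. ?g \<sigma>)"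
    by (rule sum.union_disjoint)
      (auto simp: X_def intro: finite_subset[OF _ finite_permutations[of "{..<Suc n}"]])
  also have "(\<Sum>\<sigma> | \<sigma> permutes {..<Suc n} \<and> \<sigma> n = n. ?g \<sigma>)
      = (\<Sum>\<sigma> | \<sigma> permutes {..<n}. matching_term M n \<sigma>) * M n (Suc n)"
    unfolding permutes_lessThan_fix_last sum_distrib_right
    by (rule sum.cong) (simp_all add: permutes_not_in)
  also have "(\<Sum>\<sigma> | \<sigma> permutes {..<n}. matching_term M n \<sigma>) = ?c * matching_sum M n"
    unfolding n_def matching_sum_def
    by (rule sum_permutations_eq_card_mult_matchings[where M = M, OF skew])
  finally have split: "?c * (matching_sum M (2 * Suc (Suc q)) - M n (Suc n) * matching_sum M n)
      = (\<Sum>\<sigma>\<in>X. ?g \<sigma>)"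
    by (simp add: algebra_simps)
  have "(\<Sum>\<sigma>\<in>X. ?g \<sigma>) = of_nat (2 * Suc q) * (\<Sum>\<sigma> | \<sigma> \<in> X \<and> \<sigma> (Suc (2 * q)) = n. ?g \<sigma>)"
  proof (rule sum_eq_mult_sum_last_position)
    show "finite X"
      by (auto simp: X_def intro: finite_subset[OF _ finite_permutations[of "{..<Suc n}"]])
    fix \<sigma> assume "\<sigma> \<in> X"
    then have \<sigma>: "\<sigma> permutes {..<Suc n}" "\<sigma> n \<noteq> n"
      by (auto simp: X_def)
    show "inj \<sigma>"
      using \<sigma>(1) by (rule permutes_inj)
    have "n \<in> \<sigma> ` {..<Suc n}"
      using permutes_image[OF \<sigma>(1)] by simp
    with \<sigma>(2) show "\<exists>j<2 * Suc q. \<sigma> j = n"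
      unfolding n_def[symmetric] by (metis imageE lessThan_iff less_antisym)
    fix h assume h: "h \<in> hyperoctahedral (2 * Suc q)"
    then have perm_h: "h permutes {..<n}"
      unfolding n_def by (rule hyperoctahedralD(1))
    then have hn: "h n = n"
      by (simp add: permutes_not_in)
    have "h permutes {..<Suc n}"
      using perm_h by (rule permutes_subset) simp
    then show "\<sigma> \<circ> h \<in> X"
      using \<sigma> hn by (simp add: X_def permutes_compose)
    have "permutation \<sigma>"
      using \<sigma>(1) by (auto intro: permutes_imp_permutation)
    then show "?g (\<sigma> \<circ> h) = ?g \<sigma>"
      using matching_term_hyperoctahedral[where M = M, OF skew _ h] hn by (simp add: n_def)
  qed
  also have "(\<Sum>\<sigma> | \<sigma> \<in> X \<and> \<sigma> (Suc (2 * q)) = n. ?g \<sigma>) = - ?R"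
    unfolding sum_negf[symmetric]
  proof (rule sum.reindex_bij_witness[of _
        "\<lambda>\<sigma>. \<sigma> \<circ> Transposition.transpose (Suc (2 * q)) n" "\<lambda>\<sigma>. \<sigma> \<circ> Transposition.transpose (Suc (2 * q)) n"])
    let ?t = "Transposition.transpose (Suc (2 * q)) n"
    have t: "?t permutes {..<Suc n}"
      by (rule permutes_swap_id) (simp_all add: n_def)
    have n_eq: "n = Suc (Suc (2 * q))"
      by (simp add: n_def)
    have t_apply: "?t n = Suc (2 * q)" "?t (Suc (2 * q)) = n" "\<And>i. i < Suc (2 * q) \<Longrightarrow> ?t i = i"
      by (auto simp: n_eq Transposition.transpose_def)
    show "\<sigma> \<circ> ?t \<circ> ?t = \<sigma>" for \<sigma>
      by (simp add: comp_assoc)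
    then show "\<sigma> \<circ> ?t \<circ> ?t = \<sigma>" for \<sigma> .
    {
      fix \<sigma> assume "\<sigma> \<in> {\<sigma>. \<sigma> permutes {..<n}}"
      then have \<sigma>: "\<sigma> permutes {..<n}" by simp
      then have "\<sigma> \<circ> ?t permutes {..<Suc n}"
        by (intro permutes_compose[OF t]) (rule permutes_subset, auto)
      moreover have "(\<sigma> \<circ> ?t) (Suc (2 * q)) = n"
        using \<sigma> by (simp add: t_apply permutes_not_in)
      moreover have "(\<sigma> \<circ> ?t) n \<noteq> n"
        using permutes_in_image[OF \<sigma>, of "Suc (2 * q)"] by (simp add: t_apply n_def)
      ultimately show "\<sigma> \<circ> ?t \<in> {\<sigma>. \<sigma> \<in> X \<and> \<sigma> (Suc (2 * q)) = n}"
        by (simp add: X_def)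
    }
    fix \<sigma> assume "\<sigma> \<in> {\<sigma>. \<sigma> \<in> X \<and> \<sigma> (Suc (2 * q)) = n}"
    then have \<sigma>: "\<sigma> permutes {..<Suc n}" "\<sigma> (Suc (2 * q)) = n"
      by (auto simp: X_def)
    have "\<sigma> \<circ> ?t permutes {..<Suc n}"
      using t \<sigma>(1) by (rule permutes_compose)
    moreover have "(\<sigma> \<circ> ?t) n = n"
      using \<sigma>(2) by (simp add: t_apply)
    ultimately show "\<sigma> \<circ> ?t \<in> {\<sigma>. \<sigma> permutes {..<n}}"
      using permutes_lessThan_fix_last[of n] by blast
    have "permutation \<sigma>"
      using \<sigma>(1) by (auto intro: permutes_imp_permutation)
    then have "sign (\<sigma> \<circ> ?t) = - sign \<sigma>"
      by (simp add: sign_compose sign_swap_id permutation_swap_id n_def)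
    then have "matching_term M (2 * q) (\<sigma> \<circ> ?t) = - matching_term M (2 * q) \<sigma>"
      by (simp add: matching_term_def t_apply)
    then show "- (matching_term M (2 * q) (\<sigma> \<circ> ?t) * M ((\<sigma> \<circ> ?t) (2 * q)) n
        * M ((\<sigma> \<circ> ?t) (Suc (2 * q))) (Suc n)) = ?g \<sigma>"
      unfolding n_def[THEN arg_cong[where f = "\<lambda>n. matching_term M n \<sigma>"]]
        matching_term_Suc
      by (simp add: t_apply \<sigma>(2))
  qed
  finally have "of_nat (2 * Suc q) * (of_nat (card (hyperoctahedral (2 * q)))
      * (matching_sum M (2 * Suc (Suc q)) - M n (Suc n) * matching_sum M n)) = of_nat (2 * Suc q) * - ?R"
    unfolding split[symmetric] by (simp only: n_def card_hyperoctahedral_Suc of_nat_mult mult.assoc)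
  then show ?thesis
    by (subst (asm) mult_left_cancel) (simp_all del: of_nat_Suc add: of_nat_eq_0_iff)
qed

section \<open>Integrals of products with signs\<close>

lemma product_sigma_finite_lborel: "product_sigma_finite (\<lambda>_::nat. lborel :: real measure)"
  by standard

lemma integrable_mult_bounded_left:
  fixes f :: "'b \<Rightarrow> 'a::{real_normed_field, banach, second_countable_topology}"
  assumes f: "integrable M f" and g: "g \<in> borel_measurable M" and bound: "\<And>x. norm (g x) \<le> 1"
  shows "integrable M (\<lambda>x. g x * f x)"
proof (rule Bochner_Integration.integrable_bound[OF f])
  show "(\<lambda>x. g x * f x) \<in> borel_measurable M"
    using f g by auto
  show "AE x in M. norm (g x * f x) \<le> norm (f x)"
    using bound by (intro always_eventually allI) (simp add: norm_mult mult_left_le_one_le)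
qed

lemma borel_measurable_order_sign [measurable (raw)]:
  fixes f g :: "'b \<Rightarrow> real"
  assumes [measurable]: "f \<in> borel_measurable M" "g \<in> borel_measurable M"
  shows "(\<lambda>x. order_sign (f x) (g x) :: 'a::{ring_1, topological_space}) \<in> borel_measurable M"
  unfolding order_sign_def by measurable

lemma norm_order_sign_le: "norm (order_sign x y :: 'a::real_normed_algebra_1) \<le> 1"
  by (simp add: order_sign_def)

definition order_sign_prod :: "nat \<Rightarrow> (nat \<Rightarrow> 'b::linorder) \<Rightarrow> 'a::comm_ring_1" where
  "order_sign_prod d x = (\<Prod>k<d div 2. order_sign (x (2 * k)) (x (Suc (2 * k))))"

lemma norm_order_sign_prod_le: "norm (order_sign_prod d x :: 'a::real_normed_field) \<le> 1"
  unfolding order_sign_prod_def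
  by (subst prod_norm[symmetric]) (intro prod_le_1 conjI norm_ge_zero norm_order_sign_le)

lemma borel_measurable_order_sign_prod [measurable]:
  "(order_sign_prod d :: (nat \<Rightarrow> real) \<Rightarrow> 'a::{real_normed_field, second_countable_topology})
    \<in> borel_measurable (\<Pi>\<^sub>M i\<in>{..<d}. lborel)"
  unfolding order_sign_prod_def
proof (rule borel_measurable_prod)
  fix k assume "k \<in> {..<d div 2}"
  then have "2 * k < d" "Suc (2 * k) < d" by auto
  then have "(\<lambda>x :: nat \<Rightarrow> real. x (2 * k)) \<in> borel_measurable (\<Pi>\<^sub>M i\<in>{..<d}. lborel)"
      "(\<lambda>x :: nat \<Rightarrow> real. x (Suc (2 * k))) \<in> borel_measurable (\<Pi>\<^sub>M i\<in>{..<d}. lborel)"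
    by (auto simp flip: measurable_lborel1)
  then show "(\<lambda>x :: nat \<Rightarrow> real. order_sign (x (2 * k)) (x (Suc (2 * k))) :: 'a)
      \<in> borel_measurable (\<Pi>\<^sub>M i\<in>{..<d}. lborel)"
    by (rule borel_measurable_order_sign)
qed

lemma integrable_order_sign_prod_mult:
  fixes f :: "nat \<Rightarrow> real \<Rightarrow> 'a::{real_normed_field, banach, second_countable_topology}"
  assumes "\<And>j. j < d \<Longrightarrow> integrable lborel (f j)"
  shows "integrable (\<Pi>\<^sub>M i\<in>{..<d}. lborel) (\<lambda>x. order_sign_prod d x * (\<Prod>j<d. f j (x j)))"
proof (rule integrable_mult_bounded_left)
  interpret product_sigma_finite "\<lambda>_::nat. lborel :: real measure"
    by (rule product_sigma_finite_lborel)
  show "integrable (\<Pi>\<^sub>M i\<in>{..<d}. lborel) (\<lambda>x. \<Prod>j<d. f j (x j))"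
    using assms by (intro product_integrable_prod) auto
qed (simp_all add: norm_order_sign_prod_le)

text \<open>The skew form whose values are the entries of \<open>pair_integral_mat\<close>. The iterated integral over the
whole plane, instead of the integral over a half-plane, is what the factors of a Pfaffian product
become under Fubini.\<close>

definition sign_pair_integral ::
  "(real \<Rightarrow> 'a::{real_normed_field, banach, second_countable_topology}) \<Rightarrow> (real \<Rightarrow> 'a) \<Rightarrow> 'a" where
  "sign_pair_integral f g = (\<integral>x. (\<integral>y. order_sign x y * (f x * g y) \<partial>lborel) \<partial>lborel)"

lemma integrable_mult_pair:
  fixes f g :: "real \<Rightarrow> 'a::{real_normed_field, banach, second_countable_topology}"
  assumes f: "integrable lborel f" and g: "integrable lborel g"
  shows "integrable (lborel \<Otimes>\<^sub>M lborel) (\<lambda>(x, y). f x * g y)"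
proof (rule lborel_pair.Fubini_integrable)
  have [measurable]: "f \<in> borel_measurable borel" "g \<in> borel_measurable borel"
    using f g by auto
  show "(\<lambda>(x, y). f x * g y) \<in> borel_measurable (lborel \<Otimes>\<^sub>M lborel)"
    by measurable
  show "integrable lborel (\<lambda>x. \<integral>y. norm (case (x, y) of (x, y) \<Rightarrow> f x * g y) \<partial>lborel)"
    using f g by (simp add: norm_mult)
  show "AE x in lborel. integrable lborel (\<lambda>y. case (x, y) of (x, y) \<Rightarrow> f x * g y)"
    using g by simp
qed

text \<open>Reflecting the part with \<open>y < x\<close> along the diagonal turns it into the second product of the
determinant.\<close>

lemma sign_pair_integral_eq_ordered:
  fixes f g :: "real \<Rightarrow> 'a::{real_normed_field, banach, second_countable_topology}"
  assumes f: "integrable lborel f" and g: "integrable lborel g"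
  shows "sign_pair_integral f g =
    set_lebesgue_integral lborel {(x, y). x < y} (\<lambda>(x, y). f x * g y - f y * g x)"
proof -
  have [measurable]: "f \<in> borel_measurable borel" "g \<in> borel_measurable borel"
    using f g by auto
  let ?P = "lborel \<Otimes>\<^sub>M (lborel :: real measure)"
  define lower :: "real \<times> real \<Rightarrow> 'a" where "lower = (\<lambda>(x, y). (if x < y then 1 else 0) * (f x * g y))"
  define upper :: "real \<times> real \<Rightarrow> 'a" where "upper = (\<lambda>(x, y). (if y < x then 1 else 0) * (f x * g y))"
  have lower: "integrable ?P lower"
    using integrable_mult_bounded_left[OF integrable_mult_pair[OF f g],
        of "\<lambda>(x, y). if x < y then 1 else 0"]
    by (simp add: lower_def case_prod_unfold)
  have upper: "integrable ?P upper"
    using integrable_mult_bounded_left[OF integrable_mult_pair[OF f g],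
        of "\<lambda>(x, y). if y < x then 1 else 0"]
    by (simp add: upper_def case_prod_unfold)
  have diff: "(\<lambda>(x, y). order_sign x y * (f x * g y)) = (\<lambda>z. lower z - upper z)"
    by (auto simp: fun_eq_iff lower_def upper_def order_sign_def)
  have "sign_pair_integral f g = (\<integral>z. lower z - upper z \<partial>?P)"
    unfolding sign_pair_integral_def
    using lborel_pair.integral_fst[of "\<lambda>x y. order_sign x y * (f x * g y)"] lower upper
    unfolding diff by (simp add: Bochner_Integration.integrable_diff)
  also have "\<dots> = (\<integral>z. lower z \<partial>?P) - (\<integral>z. upper z \<partial>?P)"
    using lower upper by (rule Bochner_Integration.integral_diff)
  also have "(\<integral>z. upper z \<partial>?P) = (\<integral>z. (case z of (x, y) \<Rightarrow> upper (y, x)) \<partial>?P)"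
    using upper by (intro lborel_pair.integral_product_swap[symmetric]) auto
  also have "(\<integral>z. lower z \<partial>?P) - \<dots> = (\<integral>z. lower z - (case z of (x, y) \<Rightarrow> upper (y, x)) \<partial>?P)"
    using lower lborel_pair.integrable_product_swap[OF upper]
    by (intro Bochner_Integration.integral_diff[symmetric])
  also have "\<dots> = set_lebesgue_integral ?P {(x, y). x < y} (\<lambda>(x, y). f x * g y - f y * g x)"
    unfolding set_lebesgue_integral_def
    by (intro Bochner_Integration.integral_cong refl) (auto simp: lower_def upper_def indicator_def)
  finally show ?thesis
    by (simp add: lborel_prod)
qed

text \<open>The integrand separates into the pairs of coordinates; the induction splits off the last pair.\<close>

lemma integral_order_sign_prod_even:
  fixes f :: "nat \<Rightarrow> real \<Rightarrow> 'a::{real_normed_field, banach, second_countable_topology}"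
  assumes "\<And>j. j < 2 * m \<Longrightarrow> integrable lborel (f j)"
  shows "(\<integral>x. order_sign_prod (2 * m) x * (\<Prod>j<2 * m. f j (x j)) \<partial>(\<Pi>\<^sub>M i\<in>{..<2 * m}. lborel))
    = (\<Prod>k<m. sign_pair_integral (f (2 * k)) (f (Suc (2 * k))))"
  using assms
proof (induction m)
  case 0
  interpret product_sigma_finite "\<lambda>_::nat. lborel :: real measure"
    by (rule product_sigma_finite_lborel)
  show ?case
    using product_integral_prod[of "{}" "\<lambda>_ _. 1 :: 'a"] by (simp add: order_sign_prod_def)
next
  case (Suc m)
  interpret product_sigma_finite "\<lambda>_::nat. lborel :: real measure"
    by (rule product_sigma_finite_lborel)
  let ?I = "{..<2 * m}" and ?a = "2 * m" and ?b = "Suc (2 * m)"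
  let ?F = "\<lambda>d x. order_sign_prod d x * (\<Prod>j<d. f j (x j))"
  let ?G = "\<lambda>y. order_sign (y ?a) (y ?b) * (f ?a (y ?a) * f ?b (y ?b))"
  have fa: "integrable lborel (f ?a)" and fb: "integrable lborel (f ?b)"
    using Suc.prems by auto
  then have [measurable]: "f ?a \<in> borel_measurable borel" "f ?b \<in> borel_measurable borel"
    by auto
  have dom: "{..<2 * Suc m} = ?I \<union> {?a, ?b}"
    by auto
  have "(\<integral>x. ?F (2 * Suc m) x \<partial>(\<Pi>\<^sub>M i\<in>{..<2 * Suc m}. lborel))
      = (\<integral>x. (\<integral>y. ?F (2 * Suc m) (merge ?I {?a, ?b} (x, y)) \<partial>(\<Pi>\<^sub>M i\<in>{?a, ?b}. lborel)) \<partial>(\<Pi>\<^sub>M i\<in>?I. lborel))"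
    using integrable_order_sign_prod_mult[of "2 * Suc m" f] Suc.prems
    unfolding dom by (intro product_integral_fold) auto
  also have "\<dots> = (\<integral>x. (\<integral>y. ?F ?a x * ?G y \<partial>(\<Pi>\<^sub>M i\<in>{?a, ?b}. lborel)) \<partial>(\<Pi>\<^sub>M i\<in>?I. lborel))"
  proof (intro Bochner_Integration.integral_cong refl)
    fix x y :: "nat \<Rightarrow> real"
    let ?z = "merge ?I {?a, ?b} (x, y)"
    have z: "?z j = x j" if "j < ?a" for j
      using that by (simp add: merge_def)
    have zab: "?z ?a = y ?a" "?z ?b = y ?b"
      by (simp_all add: merge_def)
    have "(order_sign_prod (2 * m) ?z :: 'a) = order_sign_prod (2 * m) x"
      unfolding order_sign_prod_def by (intro prod.cong refl) (simp add: z)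
    moreover have "(\<Prod>j<2 * m. f j (?z j)) = (\<Prod>j<2 * m. f j (x j))"
      by (intro prod.cong refl) (simp add: z)
    ultimately show "?F (2 * Suc m) ?z = ?F ?a x * ?G y"
      by (simp add: zab order_sign_prod_def)
  qed
  also have "\<dots> = (\<integral>x. ?F ?a x \<partial>(\<Pi>\<^sub>M i\<in>?I. lborel)) * (\<integral>y. ?G y \<partial>(\<Pi>\<^sub>M i\<in>{?a, ?b}. lborel))"
    by simp
  also have "(\<integral>x. ?F ?a x \<partial>(\<Pi>\<^sub>M i\<in>?I. lborel)) = (\<Prod>k<m. sign_pair_integral (f (2 * k)) (f (Suc (2 * k))))"
    using Suc.prems by (intro Suc.IH) auto
  also have "(\<integral>y. ?G y \<partial>(\<Pi>\<^sub>M i\<in>{?a, ?b}. lborel)) = sign_pair_integral (f ?a) (f ?b)"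
  proof -
    have "integrable (\<Pi>\<^sub>M i\<in>insert ?b {?a}. lborel) (\<lambda>y. \<Prod>j\<in>{?a, ?b}. f j (y j))"
      using fa fb by (subst insert_commute, intro product_integrable_prod) auto
    then have "integrable (\<Pi>\<^sub>M i\<in>insert ?b {?a}. lborel) (\<lambda>y. f ?a (y ?a) * f ?b (y ?b))"
      by simp
    then have int: "integrable (\<Pi>\<^sub>M i\<in>insert ?b {?a}. lborel) ?G"
      by (rule integrable_mult_bounded_left) (measurable, rule norm_order_sign_le)
    have "(\<integral>y. ?G y \<partial>(\<Pi>\<^sub>M i\<in>insert ?b {?a}. lborel))
        = (\<integral>y. (\<integral>v. ?G (y(?b := v)) \<partial>lborel) \<partial>(\<Pi>\<^sub>M i\<in>{?a}. lborel))"
      by (intro product_integral_insert int) auto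
    also have "\<dots> = (\<integral>y. (\<integral>v. order_sign (y ?a) v * (f ?a (y ?a) * f ?b v) \<partial>lborel) \<partial>(\<Pi>\<^sub>M i\<in>{?a}. lborel))"
      by simp
    also have "\<dots> = (\<integral>u. (\<integral>v. order_sign u v * (f ?a u * f ?b v) \<partial>lborel) \<partial>lborel)"
      by (rule product_integral_singleton) measurable
    finally show ?thesis
      by (simp add: sign_pair_integral_def insert_commute)
  qed
  finally show ?case
    by simp
qed

lemma integral_order_sign_prod:
  fixes f :: "nat \<Rightarrow> real \<Rightarrow> 'a::{real_normed_field, banach, second_countable_topology}"
  assumes f: "\<And>j. j < d \<Longrightarrow> integrable lborel (f j)"
  shows "(\<integral>x. order_sign_prod d x * (\<Prod>j<d. f j (x j)) \<partial>(\<Pi>\<^sub>M i\<in>{..<d}. lborel))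
    = (\<Prod>k<d div 2. sign_pair_integral (f (2 * k)) (f (Suc (2 * k))))
      * (if odd d then integral\<^sup>L lborel (f (d - 1)) else 1)"
proof (cases d rule: nat_parity_cases)
  case (1 m)
  then show ?thesis
    using integral_order_sign_prod_even[of m f] f by simp
next
  case (2 m)
  interpret product_sigma_finite "\<lambda>_::nat. lborel :: real measure"
    by (rule product_sigma_finite_lborel)
  let ?I = "{..<2 * m}"
  let ?F = "\<lambda>d x. order_sign_prod d x * (\<Prod>j<d. f j (x j))"
  have "(\<integral>x. ?F d x \<partial>(\<Pi>\<^sub>M i\<in>insert (2 * m) ?I. lborel))
      = (\<integral>x. (\<integral>y. ?F d (x(2 * m := y)) \<partial>lborel) \<partial>(\<Pi>\<^sub>M i\<in>?I. lborel))"
    using integrable_order_sign_prod_mult[of d f] f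
    by (intro product_integral_insert) (simp_all add: 2 lessThan_Suc)
  also have "\<dots> = (\<integral>x. (\<integral>y. ?F (2 * m) x * f (2 * m) y \<partial>lborel) \<partial>(\<Pi>\<^sub>M i\<in>?I. lborel))"
  proof (intro Bochner_Integration.integral_cong refl)
    fix x :: "nat \<Rightarrow> real" and y :: real
    have "(order_sign_prod d (x(2 * m := y)) :: 'a) = order_sign_prod (2 * m) x"
      unfolding order_sign_prod_def 2 by (intro prod.cong) auto
    then show "?F d (x(2 * m := y)) = ?F (2 * m) x * f (2 * m) y"
      by (simp add: 2)
  qed
  also have "\<dots> = (\<integral>x. ?F (2 * m) x \<partial>(\<Pi>\<^sub>M i\<in>?I. lborel)) * integral\<^sup>L lborel (f (2 * m))"
    by simp
  finally show ?thesis
    using integral_order_sign_prod_even[of m f] f by (simp add: 2 lessThan_Suc)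
qed

section \<open>Permuting the coordinates\<close>

lemma space_tuples_comp:
  fixes d :: nat
  assumes "\<tau> permutes {..<d}" "x \<in> space (\<Pi>\<^sub>M i\<in>{..<d}. (lborel :: real measure))"
  shows "x \<circ> \<tau> \<in> space (\<Pi>\<^sub>M i\<in>{..<d}. lborel)"
  using assms(2) permutes_not_in[OF assms(1)]
  by (simp add: space_PiM PiE_UNIV_domain PiE_iff extensional_def)

lemma measurable_tuples_comp:
  fixes d :: nat
  assumes \<tau>: "\<tau> permutes {..<d}"
  shows "(\<lambda>x. x \<circ> \<tau>) \<in> (\<Pi>\<^sub>M i\<in>{..<d}. (lborel :: real measure)) \<rightarrow>\<^sub>M (\<Pi>\<^sub>M i\<in>{..<d}. lborel)"
  unfolding comp_def
proof (rule measurable_PiM_single')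
  fix i assume "i \<in> {..<d}"
  then have "\<tau> i \<in> {..<d}"
    using permutes_in_image[OF \<tau>] by blast
  then show "(\<lambda>x :: nat \<Rightarrow> real. x (\<tau> i)) \<in> (\<Pi>\<^sub>M i\<in>{..<d}. lborel) \<rightarrow>\<^sub>M lborel"
    by measurable
next
  show "(\<lambda>(x :: nat \<Rightarrow> real) i. x (\<tau> i)) \<in> space (\<Pi>\<^sub>M i\<in>{..<d}. lborel) \<rightarrow> (\<Pi>\<^sub>E i\<in>{..<d}. space lborel)"
  proof (rule Pi_I)
    fix x :: "nat \<Rightarrow> real" assume "x \<in> space (\<Pi>\<^sub>M i\<in>{..<d}. lborel)"
    then have "x \<circ> \<tau> \<in> space (\<Pi>\<^sub>M i\<in>{..<d}. lborel)"
      by (rule space_tuples_comp[OF \<tau>])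
    then show "(\<lambda>i. x (\<tau> i)) \<in> (\<Pi>\<^sub>E i\<in>{..<d}. space lborel)"
      by (simp only: comp_def space_PiM)
  qed
qed

lemma distr_tuples_comp:
  fixes d :: nat
  assumes \<tau>: "\<tau> permutes {..<d}"
  shows "distr (\<Pi>\<^sub>M i\<in>{..<d}. lborel) (\<Pi>\<^sub>M i\<in>{..<d}. lborel) (\<lambda>x. x \<circ> \<tau>)
    = (\<Pi>\<^sub>M i\<in>{..<d}. (lborel :: real measure))"
proof -
  interpret product_sigma_finite "\<lambda>_::nat. lborel :: real measure"
    by (rule product_sigma_finite_lborel)
  let ?P = "\<Pi>\<^sub>M i\<in>{..<d}. (lborel :: real measure)"
  let ?\<rho> = "Hilbert_Choice.inv \<tau>"
  have \<rho>: "?\<rho> permutes {..<d}"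
    using \<tau> by (rule permutes_inv)
  show ?thesis
  proof (rule PiM_eqI)
    fix A :: "nat \<Rightarrow> real set" assume A: "\<And>i. i \<in> {..<d} \<Longrightarrow> A i \<in> sets lborel"
    have "(\<lambda>x. x \<circ> \<tau>) -` Pi\<^sub>E {..<d} A \<inter> space ?P = (\<Pi>\<^sub>E i\<in>{..<d}. A (?\<rho> i))"
    proof (intro equalityI subsetI)
      fix x assume "x \<in> (\<lambda>x. x \<circ> \<tau>) -` Pi\<^sub>E {..<d} A \<inter> space ?P"
      then have x: "x \<circ> \<tau> \<in> Pi\<^sub>E {..<d} A" "x \<in> extensional {..<d}"
        by (auto simp: space_PiM PiE_def)
      have "x i \<in> A (?\<rho> i)" if "i < d" for i
        using x(1) that permutes_in_image[OF \<rho>, of i] permutes_inverses(1)[OF \<tau>, of i]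
        by (auto simp: PiE_iff dest: bspec[of _ _ "?\<rho> i"])
      with x(2) show "x \<in> (\<Pi>\<^sub>E i\<in>{..<d}. A (?\<rho> i))"
        by (auto simp: PiE_iff)
    next
      fix x assume x: "x \<in> (\<Pi>\<^sub>E i\<in>{..<d}. A (?\<rho> i))"
      then have space: "x \<in> space ?P"
        by (auto simp: space_PiM PiE_iff)
      have "x (\<tau> i) \<in> A i" if "i < d" for i
        using x that permutes_in_image[OF \<tau>, of i] permutes_inverses(2)[OF \<tau>, of i]
        by (auto simp: PiE_iff dest: bspec[of _ _ "\<tau> i"])
      then have "x \<circ> \<tau> \<in> Pi\<^sub>E {..<d} A"
        using space_tuples_comp[OF \<tau> space] by (auto simp: space_PiM PiE_iff)
      with space show "x \<in> (\<lambda>x. x \<circ> \<tau>) -` Pi\<^sub>E {..<d} A \<inter> space ?P"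
        by simp
    qed
    then have "emeasure (distr ?P ?P (\<lambda>x. x \<circ> \<tau>)) (Pi\<^sub>E {..<d} A) = emeasure ?P (\<Pi>\<^sub>E i\<in>{..<d}. A (?\<rho> i))"
      using A by (simp add: emeasure_distr measurable_tuples_comp[OF \<tau>] sets_PiM_I_finite)
    also have "\<dots> = (\<Prod>i<d. emeasure lborel (A (?\<rho> i)))"
      using A permutes_in_image[OF \<rho>] by (intro emeasure_PiM) auto
    also have "\<dots> = (\<Prod>i<d. emeasure lborel (A i))"
      using prod.permute[OF \<rho>, of "\<lambda>i. emeasure lborel (A i)"] by (simp add: comp_def)
    finally show "emeasure (distr ?P ?P (\<lambda>x. x \<circ> \<tau>)) (Pi\<^sub>E {..<d} A) = (\<Prod>i<d. emeasure lborel (A i))" .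
  qed simp_all
qed

lemma integral_tuples_comp:
  fixes d :: nat and F :: "(nat \<Rightarrow> real) \<Rightarrow> 'a::{banach, second_countable_topology}"
  assumes \<tau>: "\<tau> permutes {..<d}" and F: "F \<in> borel_measurable (\<Pi>\<^sub>M i\<in>{..<d}. lborel)"
  shows "(\<integral>x. F (x \<circ> \<tau>) \<partial>(\<Pi>\<^sub>M i\<in>{..<d}. lborel)) = (\<integral>x. F x \<partial>(\<Pi>\<^sub>M i\<in>{..<d}. lborel))"
  using integral_distr[OF measurable_tuples_comp[OF \<tau>] F] distr_tuples_comp[OF \<tau>] by simp

section \<open>Alternating integrands\<close>

text \<open>The determinant with columns \<open>x 0, \<dots>, x (d - 1)\<close> and a constant last column \<open>c\<close>. The last column is
kept separate because the functions are changed on null sets later, which is harmless for the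
integration variables but not at the free variable.\<close>

definition alternating_sum ::
  "nat \<Rightarrow> (nat \<Rightarrow> real \<Rightarrow> 'a::comm_ring_1) \<Rightarrow> (nat \<Rightarrow> 'a) \<Rightarrow> (nat \<Rightarrow> real) \<Rightarrow> 'a" where
  "alternating_sum d \<psi> c x =
    (\<Sum>\<sigma> | \<sigma> permutes {..<Suc d}. of_int (sign \<sigma>) * (\<Prod>j<d. \<psi> (\<sigma> j) (x j)) * c (\<sigma> d))"

lemma alternating_sum_comp:
  assumes \<tau>: "\<tau> permutes {..<d}"
  shows "alternating_sum d \<psi> c (x \<circ> \<tau>) = of_int (sign \<tau>) * alternating_sum d \<psi> c x"
proof -
  let ?f = "\<lambda>y \<sigma>. of_int (sign \<sigma>) * (\<Prod>j<d. \<psi> (\<sigma> j) (y j)) * c (\<sigma> d)"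
  have \<tau>': "\<tau> permutes {..<Suc d}"
    using \<tau> by (rule permutes_subset) auto
  have "alternating_sum d \<psi> c (x \<circ> \<tau>) = (\<Sum>\<sigma> | \<sigma> permutes {..<Suc d}. ?f (x \<circ> \<tau>) (\<sigma> \<circ> \<tau>))"
    unfolding alternating_sum_def by (rule sum_permutations_compose_right[OF \<tau>'])
  also have "\<dots> = (\<Sum>\<sigma> | \<sigma> permutes {..<Suc d}. of_int (sign \<tau>) * ?f x \<sigma>)"
  proof (rule sum.cong[OF refl])
    fix \<sigma> assume "\<sigma> \<in> {\<sigma>. \<sigma> permutes {..<Suc d}}"
    then have "sign (\<sigma> \<circ> \<tau>) = sign \<sigma> * sign \<tau>"
      using \<tau> by (intro sign_compose) (auto intro: permutes_imp_permutation)
    moreover have "(\<Prod>j<d. \<psi> ((\<sigma> \<circ> \<tau>) j) ((x \<circ> \<tau>) j)) = (\<Prod>j<d. \<psi> (\<sigma> j) (x j))"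
      using prod.permute[OF \<tau>, of "\<lambda>j. \<psi> (\<sigma> j) (x j)"] by (simp add: comp_def)
    moreover have "\<tau> d = d"
      using \<tau> by (simp add: permutes_not_in)
    ultimately show "?f (x \<circ> \<tau>) (\<sigma> \<circ> \<tau>) = of_int (sign \<tau>) * ?f x \<sigma>"
      by (simp add: mult_ac)
  qed
  finally show ?thesis
    by (simp add: alternating_sum_def sum_distrib_left)
qed

lemma alternating_sum_eq_0:
  fixes \<psi> :: "nat \<Rightarrow> real \<Rightarrow> 'a::field_char_0"
  assumes "\<not> inj_on x {..<d}"
  shows "alternating_sum d \<psi> c x = 0"
proof -
  obtain i j where ij: "i < d" "j < d" "i \<noteq> j" "x i = x j"
    using assms by (auto simp: inj_on_def)
  have "x \<circ> Transposition.transpose i j = x"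
    using ij by (auto simp: fun_eq_iff Transposition.transpose_def)
  moreover have "Transposition.transpose i j permutes {..<d}"
    using ij by (intro permutes_swap_id) auto
  ultimately have "alternating_sum d \<psi> c x = - alternating_sum d \<psi> c x"
    using alternating_sum_comp[of "Transposition.transpose i j" d \<psi> c x] ij
    by (simp add: sign_swap_id)
  then have "2 * alternating_sum d \<psi> c x = 0"
    by simp
  then show ?thesis by simp
qed

text \<open>The identity holds at every point, so the null set of tuples with equal coordinates needs no separate
treatment: there the left side is zero.\<close>

lemma alternating_sum_sort:
  fixes \<psi> :: "nat \<Rightarrow> real \<Rightarrow> 'a::field_char_0"
  shows "alternating_sum d \<psi> c x =
    (\<Sum>\<tau> | \<tau> permutes {..<d}. if strict_mono_on {..<d} (x \<circ> \<tau>) then alternating_sum d \<psi> c x else 0)"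
proof (cases "inj_on x {..<d}")
  case True
  then obtain \<tau> where \<tau>: "\<tau> permutes {..<d}" "strict_mono_on {..<d} (x \<circ> \<tau>)"
    by (rule sorting_permutation_exists)
  have "(\<Sum>\<rho> | \<rho> permutes {..<d}. if strict_mono_on {..<d} (x \<circ> \<rho>) then alternating_sum d \<psi> c x else 0)
      = (\<Sum>\<rho> | \<rho> permutes {..<d}. if \<rho> = \<tau> then alternating_sum d \<psi> c x else 0)"
    using sorting_permutation_unique[OF _ _ \<tau>] \<tau>(2) by (intro sum.cong refl if_cong) blast+
  also have "\<dots> = alternating_sum d \<psi> c x"
    using \<tau>(1) by (simp add: finite_permutations)
  finally show ?thesis by simp
next
  case False
  then have "alternating_sum d \<psi> c x = 0"
    by (rule alternating_sum_eq_0)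
  then show ?thesis
    by (simp only: if_cancel sum.neutral_const)
qed

lemma order_sign_prod_comp:
  assumes y: "strict_mono_on {..<d} y" and \<tau>: "\<tau> permutes {..<d}"
  shows "order_sign_prod d (y \<circ> \<tau>) * of_int (sign \<tau>)
    = (matching_term order_sign d \<tau> :: 'a::comm_ring_1)"
proof -
  have "(order_sign_prod d (y \<circ> \<tau>) :: 'a) = (\<Prod>k<d div 2. order_sign (\<tau> (2 * k)) (\<tau> (Suc (2 * k))))"
    unfolding order_sign_prod_def comp_apply
  proof (rule prod.cong[OF refl])
    fix k assume "k \<in> {..<d div 2}"
    then have "2 * k < d" "Suc (2 * k) < d" by auto
    then have "\<tau> (2 * k) \<in> {..<d}" "\<tau> (Suc (2 * k)) \<in> {..<d}"
      using permutes_in_image[OF \<tau>] by blast+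
    then show "(order_sign (y (\<tau> (2 * k))) (y (\<tau> (Suc (2 * k)))) :: 'a)
        = order_sign (\<tau> (2 * k)) (\<tau> (Suc (2 * k)))"
      by (rule order_sign_strict_mono[OF y])
  qed
  then show ?thesis
    by (simp add: matching_term_def mult.commute)
qed

lemma borel_measurable_alternating_sum [measurable]:
  fixes \<psi> :: "nat \<Rightarrow> real \<Rightarrow> 'a::{real_normed_field, banach, second_countable_topology}"
  assumes \<psi>: "\<And>i. i \<le> d \<Longrightarrow> \<psi> i \<in> borel_measurable lborel"
  shows "alternating_sum d \<psi> c \<in> borel_measurable (\<Pi>\<^sub>M i\<in>{..<d}. lborel)"
  unfolding alternating_sum_def
proof (intro borel_measurable_sum borel_measurable_times borel_measurable_prod)
  fix \<sigma> j assume \<sigma>: "\<sigma> \<in> {\<sigma>. \<sigma> permutes {..<Suc d}}" and j: "j \<in> {..<d}"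
  then have "\<sigma> j \<le> d"
    using permutes_in_image[of \<sigma> "{..<Suc d}" j] by simp
  then have "\<psi> (\<sigma> j) \<in> borel_measurable lborel"
    by (rule \<psi>)
  moreover have "(\<lambda>x :: nat \<Rightarrow> real. x j) \<in> (\<Pi>\<^sub>M i\<in>{..<d}. lborel) \<rightarrow>\<^sub>M lborel"
    using j by measurable
  ultimately show "(\<lambda>x :: nat \<Rightarrow> real. \<psi> (\<sigma> j) (x j)) \<in> borel_measurable (\<Pi>\<^sub>M i\<in>{..<d}. lborel)"
    by (rule measurable_compose[rotated])
qed simp_all

lemma pred_strict_mono_on [measurable]:
  "Measurable.pred (\<Pi>\<^sub>M i\<in>{..<d}. lborel) (\<lambda>x :: nat \<Rightarrow> real. strict_mono_on {..<d} x)"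
proof -
  have "(\<lambda>x :: nat \<Rightarrow> real. strict_mono_on {..<d} x) = (\<lambda>x. \<forall>i\<in>{..<d}. \<forall>j\<in>{..<d}. i < j \<longrightarrow> x i < x j)"
    by (auto simp: strict_mono_on_def fun_eq_iff)
  then show ?thesis by simp
qed

lemma integral_order_sign_prod_alternating_sum:
  fixes \<psi> :: "nat \<Rightarrow> real \<Rightarrow> 'a::{real_normed_field, banach, second_countable_topology}"
  assumes \<psi>: "\<And>i. i \<le> d \<Longrightarrow> integrable lborel (\<psi> i)"
  shows "integrable (\<Pi>\<^sub>M i\<in>{..<d}. lborel) (\<lambda>x. order_sign_prod d x * alternating_sum d \<psi> c x)"
    and "(\<integral>x. order_sign_prod d x * alternating_sum d \<psi> c x \<partial>(\<Pi>\<^sub>M i\<in>{..<d}. lborel))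
      = (\<Sum>\<sigma> | \<sigma> permutes {..<Suc d}. matching_term (\<lambda>i j. sign_pair_integral (\<psi> i) (\<psi> j)) d \<sigma>
          * (if odd d then integral\<^sup>L lborel (\<psi> (\<sigma> (d - 1))) else 1) * c (\<sigma> d))"
proof -
  let ?P = "(\<Pi>\<^sub>M i\<in>{..<d}. lborel) :: (nat \<Rightarrow> real) measure"
  let ?h = "\<lambda>\<sigma> x. (of_int (sign \<sigma>) * c (\<sigma> d)) * (order_sign_prod d x * (\<Prod>j<d. \<psi> (\<sigma> j) (x j)))"
  have expand: "order_sign_prod d x * alternating_sum d \<psi> c x = (\<Sum>\<sigma> | \<sigma> permutes {..<Suc d}. ?h \<sigma> x)" for x
    unfolding alternating_sum_def sum_distrib_left by (intro sum.cong refl) (simp add: mult_ac)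
  have \<psi>\<sigma>: "integrable lborel (\<psi> (\<sigma> j))" if "\<sigma> permutes {..<Suc d}" "j < d" for \<sigma> j
    using \<psi>[of "\<sigma> j"] permutes_in_image[OF that(1), of j] that(2) by simp
  have h: "integrable ?P (?h \<sigma>)" if "\<sigma> permutes {..<Suc d}" for \<sigma>
    using \<psi>\<sigma>[OF that] by (intro integrable_mult_right integrable_order_sign_prod_mult)
  show "integrable ?P (\<lambda>x. order_sign_prod d x * alternating_sum d \<psi> c x)"
    unfolding expand using h by (intro Bochner_Integration.integrable_sum) auto
  have "(\<integral>x. order_sign_prod d x * alternating_sum d \<psi> c x \<partial>?P)
      = (\<Sum>\<sigma> | \<sigma> permutes {..<Suc d}. integral\<^sup>L ?P (?h \<sigma>))"
    unfolding expand using h by (intro Bochner_Integration.integral_sum) auto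
  also have "\<dots> = (\<Sum>\<sigma> | \<sigma> permutes {..<Suc d}. matching_term (\<lambda>i j. sign_pair_integral (\<psi> i) (\<psi> j)) d \<sigma>
          * (if odd d then integral\<^sup>L lborel (\<psi> (\<sigma> (d - 1))) else 1) * c (\<sigma> d))"
  proof (rule sum.cong[OF refl])
    fix \<sigma> assume "\<sigma> \<in> {\<sigma>. \<sigma> permutes {..<Suc d}}"
    then have "(\<integral>x. order_sign_prod d x * (\<Prod>j<d. \<psi> (\<sigma> j) (x j)) \<partial>?P)
        = (\<Prod>k<d div 2. sign_pair_integral (\<psi> (\<sigma> (2 * k))) (\<psi> (\<sigma> (Suc (2 * k)))))
          * (if odd d then integral\<^sup>L lborel (\<psi> (\<sigma> (d - 1))) else 1)"
      using \<psi>\<sigma> by (intro integral_order_sign_prod) auto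
    then show "integral\<^sup>L ?P (?h \<sigma>) = matching_term (\<lambda>i j. sign_pair_integral (\<psi> i) (\<psi> j)) d \<sigma>
          * (if odd d then integral\<^sup>L lborel (\<psi> (\<sigma> (d - 1))) else 1) * c (\<sigma> d)"
      unfolding integral_mult_right_zero matching_term_def by (simp only: mult_ac)
  qed
  finally show "(\<integral>x. order_sign_prod d x * alternating_sum d \<psi> c x \<partial>?P)
      = (\<Sum>\<sigma> | \<sigma> permutes {..<Suc d}. matching_term (\<lambda>i j. sign_pair_integral (\<psi> i) (\<psi> j)) d \<sigma>
          * (if odd d then integral\<^sup>L lborel (\<psi> (\<sigma> (d - 1))) else 1) * c (\<sigma> d))" .
qed

text \<open>The right side is the integral of the alternating sum times the product of signs over all tuples. It is
decomposed by the permutation that sorts the coordinates. After the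
substitution by its inverse the alternating sum contributes the sign of that permutation, the
product of signs becomes the product over the permuted indices, and the two together sum up to the
order of the group.\<close>

lemma ordered_integral_alternating_sum:
  fixes \<psi> :: "nat \<Rightarrow> real \<Rightarrow> 'a::{real_normed_field, banach, second_countable_topology}"
  assumes \<psi>: "\<And>i. i \<le> d \<Longrightarrow> integrable lborel (\<psi> i)"
  shows "of_nat (card (hyperoctahedral (2 * (d div 2))))
      * (\<integral>x. (if strict_mono_on {..<d} x then alternating_sum d \<psi> c x else 0) \<partial>(\<Pi>\<^sub>M i\<in>{..<d}. lborel))
    = (\<Sum>\<sigma> | \<sigma> permutes {..<Suc d}. matching_term (\<lambda>i j. sign_pair_integral (\<psi> i) (\<psi> j)) d \<sigma>
          * (if odd d then integral\<^sup>L lborel (\<psi> (\<sigma> (d - 1))) else 1) * c (\<sigma> d))"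
proof -
  let ?P = "(\<Pi>\<^sub>M i\<in>{..<d}. lborel) :: (nat \<Rightarrow> real) measure"
  let ?D = "alternating_sum d \<psi> c"
  let ?S = "{\<tau>. \<tau> permutes {..<d}}"
  \<comment> \<open>The part of the integrand on the tuples that are sorted by \<open>\<tau>\<close>.\<close>
  define G where "G \<tau> x = (if strict_mono_on {..<d} (x \<circ> \<tau>) then order_sign_prod d x * ?D x else 0)" for \<tau> x
  have D_meas [measurable]: "?D \<in> borel_measurable ?P"
    using \<psi> by (intro borel_measurable_alternating_sum) auto
  have int: "integrable ?P (\<lambda>x. order_sign_prod d x * ?D x)"
    using \<psi> by (rule integral_order_sign_prod_alternating_sum(1))
  have G_int: "integrable ?P (G \<tau>)" if \<tau>: "\<tau> permutes {..<d}" for \<tau>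
  proof (rule Bochner_Integration.integrable_bound[OF int])
    note [measurable] = measurable_tuples_comp[OF \<tau>]
    have "Measurable.pred ?P (\<lambda>x. strict_mono_on {..<d} (x \<circ> \<tau>))"
      using measurable_compose[OF measurable_tuples_comp[OF \<tau>] pred_strict_mono_on] .
    then show "G \<tau> \<in> borel_measurable ?P"
      unfolding G_def by measurable
    show "AE x in ?P. norm (G \<tau> x) \<le> norm (order_sign_prod d x * ?D x)"
      by (simp add: G_def)
  qed
  have G_integral: "integral\<^sup>L ?P (G \<tau>) = matching_term order_sign d (Hilbert_Choice.inv \<tau>)
      * (\<integral>x. (if strict_mono_on {..<d} x then ?D x else 0) \<partial>?P)" if \<tau>: "\<tau> permutes {..<d}" for \<tau>
  proof -
    let ?\<rho> = "Hilbert_Choice.inv \<tau>"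
    have \<rho>: "?\<rho> permutes {..<d}"
      using \<tau> by (rule permutes_inv)
    have "integral\<^sup>L ?P (G \<tau>) = (\<integral>x. G \<tau> (x \<circ> ?\<rho>) \<partial>?P)"
      using G_int[OF \<tau>] by (intro integral_tuples_comp[OF \<rho>, symmetric]) auto
    also have "\<dots> = (\<integral>x. matching_term order_sign d ?\<rho> * (if strict_mono_on {..<d} x then ?D x else 0) \<partial>?P)"
    proof (intro Bochner_Integration.integral_cong refl)
      fix x :: "nat \<Rightarrow> real"
      have "x \<circ> ?\<rho> \<circ> \<tau> = x"
        using permutes_inv_o(2)[OF \<tau>] by (simp add: comp_assoc)
      then show "G \<tau> (x \<circ> ?\<rho>) = matching_term order_sign d ?\<rho> * (if strict_mono_on {..<d} x then ?D x else 0)"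
        by (simp add: G_def alternating_sum_comp[OF \<rho>] order_sign_prod_comp[OF _ \<rho>, symmetric] mult.assoc)
    qed
    finally show ?thesis by simp
  qed
  have "(\<integral>x. order_sign_prod d x * ?D x \<partial>?P) = (\<integral>x. (\<Sum>\<tau>\<in>?S. G \<tau> x) \<partial>?P)"
  proof (intro Bochner_Integration.integral_cong refl)
    fix x :: "nat \<Rightarrow> real"
    have "order_sign_prod d x * ?D x = order_sign_prod d x * (\<Sum>\<tau>\<in>?S. if strict_mono_on {..<d} (x \<circ> \<tau>) then ?D x else 0)"
      using alternating_sum_sort[of d \<psi> c x] by (rule arg_cong)
    also have "\<dots> = (\<Sum>\<tau>\<in>?S. G \<tau> x)"
      unfolding sum_distrib_left G_def by (intro sum.cong refl) simp
    finally show "order_sign_prod d x * ?D x = (\<Sum>\<tau>\<in>?S. G \<tau> x)" .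
  qed
  also have "\<dots> = (\<Sum>\<tau>\<in>?S. integral\<^sup>L ?P (G \<tau>))"
    using G_int by (intro Bochner_Integration.integral_sum) auto
  also have "\<dots> = (\<Sum>\<tau>\<in>?S. matching_term order_sign d (Hilbert_Choice.inv \<tau>))
      * (\<integral>x. (if strict_mono_on {..<d} x then ?D x else 0) \<partial>?P)"
    unfolding sum_distrib_right using G_integral by (intro sum.cong refl) auto
  also have "(\<Sum>\<tau>\<in>?S. matching_term order_sign d (Hilbert_Choice.inv \<tau>))
      = (of_nat (card (hyperoctahedral (2 * (d div 2)))) :: 'a)"
    using sum_permutations_inverse[of "matching_term order_sign d :: _ \<Rightarrow> 'a" "{..<d}"]
      sum_matching_term_order_sign[of d, where 'a = 'a] by simp
  finally show ?thesis
    using integral_order_sign_prod_alternating_sum(2)[OF \<psi>, where c = c] by simp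
qed

section \<open>From Lebesgue to Borel measurable functions\<close>

text \<open>Fubini is applied to Borel measurable versions of the functions. A limit of simple functions has one
because each simple function does.\<close>

lemma completion_ex_borel_measurable_AE:
  fixes f :: "'b \<Rightarrow> 'a::{banach, second_countable_topology}"
  assumes f: "f \<in> borel_measurable (completion M)"
  obtains g where "g \<in> borel_measurable M" and "AE x in M. f x = g x"
proof -
  obtain s where s: "\<And>i. simple_function (completion M) (s i)"
    and lim: "\<And>x. x \<in> space M \<Longrightarrow> (\<lambda>i. s i x) \<longlonglongrightarrow> f x"
    using borel_measurable_implies_sequence_metric[OF f, of 0] by auto
  obtain s' where s': "\<And>i. simple_function M (s' i)" and eq: "\<And>i. AE x in M. s i x = s' i x"
    using completion_ex_simple_function[OF s] by metis
  show ?thesis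
  proof (rule that)
    show "(\<lambda>x. lim (\<lambda>i. s' i x)) \<in> borel_measurable M"
      by (intro borel_measurable_lim_metric borel_measurable_simple_function s')
    have "AE x in M. \<forall>i. s i x = s' i x"
      using eq by (simp add: AE_all_countable)
    then show "AE x in M. f x = lim (\<lambda>i. s' i x)"
      using AE_space
    proof eventually_elim
      case (elim x)
      then have "(\<lambda>i. s' i x) \<longlonglongrightarrow> f x"
        using lim[of x] by simp
      then show ?case
        by (simp add: limI)
    qed
  qed
qed

text \<open>Completeness makes measurability insensitive to changes on null sets, so the integrals of
\<open>integral_completion_AE_cong\<close> may be compared without a measurability assumption on \<open>f\<close>.\<close>

lemma (in complete_measure) measurable_AE_cong:
  assumes f: "f \<in> M \<rightarrow>\<^sub>M N" and eq: "AE x in M. f x = g x" and g: "g \<in> space M \<rightarrow> space N"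
  shows "g \<in> M \<rightarrow>\<^sub>M N"
proof (rule measurableI)
  fix A assume A: "A \<in> sets N"
  show "g -` A \<inter> space M \<in> sets M"
  proof (rule in_sets_AE)
    show "f -` A \<inter> space M \<in> sets M"
      using f A by (rule measurable_sets)
    show "AE x in M. x \<in> f -` A \<inter> space M \<longleftrightarrow> x \<in> g -` A \<inter> space M"
      using eq by eventually_elim auto
  qed auto
qed (use g in auto)

lemma integral_completion_AE_cong:
  fixes f g :: "'b \<Rightarrow> 'a::{banach, second_countable_topology}"
  assumes g: "g \<in> borel_measurable M" and eq: "AE x in M. f x = g x"
  shows "integral\<^sup>L (completion M) f = integral\<^sup>L M g"
proof -
  have g': "g \<in> borel_measurable (completion M)"
    using g by (rule measurable_completion)
  have eq': "AE x in completion M. f x = g x"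
    using eq by (rule AE_completion)
  have "f \<in> borel_measurable (completion M)"
    by (rule completion.measurable_AE_cong[OF g']) (use eq' in auto)
  then have "integral\<^sup>L (completion M) f = integral\<^sup>L (completion M) g"
    using g' eq' by (rule integral_cong_AE)
  also have "\<dots> = integral\<^sup>L M g"
    using g by (rule integral_completion)
  finally show ?thesis .
qed

lemma integrable_lebesgue_ex_integrable_lborel:
  fixes f :: "'b::euclidean_space \<Rightarrow> 'a::{banach, second_countable_topology}"
  assumes f: "integrable lebesgue f"
  obtains g where "integrable lborel g" and "AE x in lborel. f x = g x"
proof -
  obtain g where g: "g \<in> borel_measurable lborel" "AE x in lborel. f x = g x"
    using f completion_ex_borel_measurable_AE[of f lborel] by auto
  have "integrable lebesgue f \<longleftrightarrow> integrable lebesgue g"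
    using f g by (intro integrable_cong_AE) (auto intro: measurable_completion AE_completion)
  with f have "integrable lebesgue g"
    by simp
  then have "integrable lborel g"
    using g(1) by (simp add: integrable_completion)
  with g(2) that show ?thesis by blast
qed

lemma AE_tuples_component:
  assumes AE: "AE u in lborel. Q (u :: real)" and j: "j < (d :: nat)"
  shows "AE x in (\<Pi>\<^sub>M i\<in>{..<d}. lborel). Q (x j)"
proof -
  interpret product_sigma_finite "\<lambda>_::nat. lborel :: real measure"
    by (rule product_sigma_finite_lborel)
  obtain N where N: "{u. \<not> Q u} \<subseteq> N" "emeasure lborel N = 0" "N \<in> sets lborel"
    using AE by (auto elim: AE_E)
  define B where "B i = (if i = j then N else UNIV)" for i
  have "emeasure (\<Pi>\<^sub>M i\<in>{..<d}. lborel) (Pi\<^sub>E {..<d} B) = (\<Prod>i<d. emeasure lborel (B i))"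
    using N(3) by (intro emeasure_PiM) (auto simp: B_def)
  also have "\<dots> = 0"
    using j N(2) by (intro prod_zero) (auto simp: B_def intro!: bexI[of _ j])
  finally have "Pi\<^sub>E {..<d} B \<in> null_sets (\<Pi>\<^sub>M i\<in>{..<d}. lborel)"
    using N(3) by (auto simp: B_def intro!: null_setsI sets_PiM_I_finite)
  then show ?thesis
    by (rule AE_I') (use N(1) j in \<open>auto simp: space_PiM PiE_def B_def\<close>)
qed

lemma AE_lborel_fst_snd:
  assumes "AE u in lborel. Q (u :: real)"
  shows "AE z in lborel. Q (fst (z :: real \<times> real)) \<and> Q (snd z)"
proof -
  obtain N where N: "{u. \<not> Q u} \<subseteq> N" "emeasure lborel N = 0" "N \<in> sets lborel"
    using assms by (auto elim: AE_E)
  have "emeasure (lborel \<Otimes>\<^sub>M lborel) (N \<times> UNIV) = 0" "emeasure (lborel \<Otimes>\<^sub>M lborel) (UNIV \<times> N) = 0"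
    using N(2,3) by (simp_all add: lborel.emeasure_pair_measure_Times)
  then have "N \<times> UNIV \<in> null_sets (lborel \<Otimes>\<^sub>M lborel)" "UNIV \<times> N \<in> null_sets (lborel \<Otimes>\<^sub>M lborel)"
    using N(3) by (auto intro!: null_setsI pair_measureI)
  then have "N \<times> UNIV \<union> UNIV \<times> N \<in> null_sets (lborel :: (real \<times> real) measure)"
    unfolding lborel_prod by (rule null_sets.Un)
  then show ?thesis
    by (rule AE_I') (use N(1) in auto)
qed

section \<open>The determinants and matrices of the theorem\<close>

text \<open>The matrix is transposed first, since \<open>alternating_sum\<close> permutes the functions and not the
variables.\<close>

lemma det_eq_alternating_sum:
  "Determinant.det (Matrix.mat (d + 1) (d + 1) (\<lambda>(i, j). \<phi> i ((x(d := t)) j)))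
    = alternating_sum d \<phi> (\<lambda>i. \<phi> i t) x"
proof -
  let ?A = "Matrix.mat (d + 1) (d + 1) (\<lambda>(i, j). \<phi> i ((x(d := t)) j))"
  have A: "?A \<in> carrier_mat (Suc d) (Suc d)"
    by simp
  have "Determinant.det ?A = Determinant.det (transpose_mat ?A)"
    using A by (rule det_transpose[symmetric])
  also have "\<dots> = (\<Sum>\<sigma> | \<sigma> permutes {..<Suc d}. of_int (sign \<sigma>) *
      (\<Prod>i<Suc d. transpose_mat ?A $$ (i, \<sigma> i)))"
    using A by (subst det_def'[of _ "Suc d"]) (auto simp: atLeast0LessThan)
  also have "\<dots> = alternating_sum d \<phi> (\<lambda>i. \<phi> i t) x"
    unfolding alternating_sum_def
  proof (rule sum.cong[OF refl])
    fix \<sigma> assume "\<sigma> \<in> {\<sigma>. \<sigma> permutes {..<Suc d}}"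
    then have \<sigma>: "\<sigma> i < Suc d" if "i < Suc d" for i
      using that permutes_in_image[of \<sigma> "{..<Suc d}" i] by simp
    have "(\<Prod>i<Suc d. transpose_mat ?A $$ (i, \<sigma> i)) = (\<Prod>i<Suc d. \<phi> (\<sigma> i) ((x(d := t)) i))"
      using \<sigma> by (intro prod.cong refl) simp
    also have "\<dots> = (\<Prod>i<d. \<phi> (\<sigma> i) (x i)) * \<phi> (\<sigma> d) t"
      by simp
    finally show "of_int (sign \<sigma>) * (\<Prod>i<Suc d. transpose_mat ?A $$ (i, \<sigma> i))
        = of_int (sign \<sigma>) * (\<Prod>i<d. \<phi> (\<sigma> i) (x i)) * \<phi> (\<sigma> d) t"
      by (simp add: mult.assoc)
  qed
  finally show ?thesis .
qed

lemma ordered_det_integral_eq: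
  fixes \<phi> \<psi> :: "nat \<Rightarrow> real \<Rightarrow> 'a::{real_normed_field, banach, second_countable_topology}"
  assumes \<psi>: "\<And>i. i \<le> d \<Longrightarrow> integrable lborel (\<psi> i)"
    and eq: "\<And>i. i \<le> d \<Longrightarrow> AE u in lborel. \<phi> i u = \<psi> i u"
  shows "ordered_det_integral d \<phi> t =
    (\<integral>x. (if strict_mono_on {..<d} x then alternating_sum d \<psi> (\<lambda>i. \<phi> i t) x else 0)
      \<partial>(\<Pi>\<^sub>M i\<in>{..<d}. lborel))"
  unfolding ordered_det_integral_def lebesgue_tuples_def set_lebesgue_integral_def det_eq_alternating_sum
proof (rule integral_completion_AE_cong)
  have [measurable]: "alternating_sum d \<psi> (\<lambda>i. \<phi> i t) \<in> borel_measurable (\<Pi>\<^sub>M i\<in>{..<d}. lborel)"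
    using \<psi> by (intro borel_measurable_alternating_sum) auto
  show "(\<lambda>x. if strict_mono_on {..<d} x then alternating_sum d \<psi> (\<lambda>i. \<phi> i t) x else 0)
      \<in> borel_measurable (\<Pi>\<^sub>M i\<in>{..<d}. lborel)"
    by measurable
  have "AE x in (\<Pi>\<^sub>M i\<in>{..<d}. lborel). \<forall>i\<in>{..d}. \<forall>j\<in>{..<d}. \<phi> i (x j) = \<psi> i (x j)"
    by (intro AE_finite_allI finite_atMost finite_lessThan AE_tuples_component eq) auto
  then show "AE x in (\<Pi>\<^sub>M i\<in>{..<d}. lborel).
      indicator {x. strict_mono_on {..<d} x} x *\<^sub>R alternating_sum d \<phi> (\<lambda>i. \<phi> i t) x =
      (if strict_mono_on {..<d} x then alternating_sum d \<psi> (\<lambda>i. \<phi> i t) x else 0)"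
  proof eventually_elim
    case (elim x)
    have "alternating_sum d \<phi> (\<lambda>i. \<phi> i t) x = alternating_sum d \<psi> (\<lambda>i. \<phi> i t) x"
      unfolding alternating_sum_def
    proof (intro sum.cong refl arg_cong2[where f = times] prod.cong)
      fix \<sigma> j assume "\<sigma> \<in> {\<sigma>. \<sigma> permutes {..<Suc d}}" "j \<in> {..<d}"
      then have "\<sigma> j \<in> {..d}"
        using permutes_in_image[of \<sigma> "{..<Suc d}" j] by simp
      with \<open>j \<in> {..<d}\<close> elim show "\<phi> (\<sigma> j) (x j) = \<psi> (\<sigma> j) (x j)"
        by blast
    qed
    then show ?case by simp
  qed
qed

lemma pair_integral_mat_index:
  fixes \<phi> \<psi> :: "nat \<Rightarrow> real \<Rightarrow> 'a::{real_normed_field, banach, second_countable_topology}"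
  assumes \<psi>: "\<And>i. i \<le> d \<Longrightarrow> integrable lborel (\<psi> i)"
    and eq: "\<And>i. i \<le> d \<Longrightarrow> AE u in lborel. \<phi> i u = \<psi> i u"
    and ij: "i \<le> d" "j \<le> d"
  shows "pair_integral_mat d \<phi> $$ (i, j) = sign_pair_integral (\<psi> i) (\<psi> j)"
proof -
  have det2: "Determinant.det (mat_of_rows_list 2 [[\<phi> i x, \<phi> i y], [\<phi> j x, \<phi> j y]])
      = \<phi> i x * \<phi> j y - \<phi> i y * \<phi> j x" for x y
  proof -
    have "{\<pi>. \<pi> permutes {0..<2 :: nat}} = {id, Transposition.transpose 0 1}"
      by (auto simp: numeral_2_eq_2 atLeast0_lessThan_Suc permutes_doubleton_iff insert_commute)
    moreover have "id \<noteq> Transposition.transpose 0 (1 :: nat)"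
      by (metis id_apply transpose_apply_first zero_neq_one)
    ultimately show ?thesis
      by (subst det_def'[of _ 2])
        (simp_all add: mat_of_rows_list_def numeral_2_eq_2 sign_swap_id)
  qed
  have [measurable]: "\<psi> i \<in> borel_measurable borel" "\<psi> j \<in> borel_measurable borel"
    using \<psi> ij by auto
  have "pair_integral_mat d \<phi> $$ (i, j) =
      (\<integral>z. indicator {(x, y). x < y} z *\<^sub>R (case z of (x, y) \<Rightarrow> \<phi> i x * \<phi> j y - \<phi> i y * \<phi> j x) \<partial>lebesgue)"
    using ij by (simp add: pair_integral_mat_def det2 set_lebesgue_integral_def)
  also have "\<dots> = (\<integral>z. indicator {(x, y). x < y} z *\<^sub>R (case z of (x, y) \<Rightarrow> \<psi> i x * \<psi> j y - \<psi> i y * \<psi> j x) \<partial>lborel)"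
  proof (rule integral_completion_AE_cong)
    have "{(x, y). x < (y :: real)} \<in> sets borel"
      by (simp add: borel_open open_Collect_less case_prod_unfold continuous_on_fst continuous_on_snd)
    then show "(\<lambda>z. indicator {(x, y). x < y} z *\<^sub>R (case z of (x, y) \<Rightarrow> \<psi> i x * \<psi> j y - \<psi> i y * \<psi> j x))
        \<in> borel_measurable lborel"
      by (intro borel_measurable_scaleR borel_measurable_indicator)
        (simp_all add: case_prod_unfold borel_prod[symmetric])
    show "AE z in lborel. indicator {(x, y). x < y} z *\<^sub>R (case z of (x, y) \<Rightarrow> \<phi> i x * \<phi> j y - \<phi> i y * \<phi> j x)
        = indicator {(x, y). x < y} z *\<^sub>R (case z of (x, y) \<Rightarrow> \<psi> i x * \<psi> j y - \<psi> i y * \<psi> j x)"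
      using AE_lborel_fst_snd[OF eq[OF ij(1)]] AE_lborel_fst_snd[OF eq[OF ij(2)]]
      by eventually_elim (simp add: case_prod_unfold)
  qed
  also have "\<dots> = sign_pair_integral (\<psi> i) (\<psi> j)"
    using sign_pair_integral_eq_ordered[OF \<psi>[OF ij(1)] \<psi>[OF ij(2)]]
    by (simp add: set_lebesgue_integral_def)
  finally show ?thesis .
qed

lemma sign_pair_integral_skew:
  fixes f g :: "real \<Rightarrow> 'a::{real_normed_field, banach, second_countable_topology}"
  assumes f: "integrable lborel f" and g: "integrable lborel g"
  shows "sign_pair_integral f g = - sign_pair_integral g f"
  unfolding sign_pair_integral_eq_ordered[OF f g] sign_pair_integral_eq_ordered[OF g f]
    set_lebesgue_integral_def Bochner_Integration.integral_minus[symmetric]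
  by (intro Bochner_Integration.integral_cong refl) (auto simp: algebra_simps)

lemma integral_vec_index:
  fixes \<phi> \<psi> :: "nat \<Rightarrow> real \<Rightarrow> 'a::{real_normed_field, banach, second_countable_topology}"
  assumes \<psi>: "integrable lborel (\<psi> i)"
    and eq: "AE u in lborel. \<phi> i u = \<psi> i u" and i: "i \<le> d"
  shows "integral_vec d \<phi> $ i = integral\<^sup>L lborel (\<psi> i)"
  using i integral_completion_AE_cong[OF _ eq] \<psi> by (simp add: integral_vec_def)

section \<open>The Pfaffians of the theorem\<close>

lemma pfaffian_eq_matching_sum:
  assumes dim: "dim_row A = n" "even n"
    and entries: "\<And>i j. i < n \<Longrightarrow> j < n \<Longrightarrow> A $$ (i, j) = M i j"
  shows "pfaffian A = matching_sum M n"
proof -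
  have "{\<pi>. \<pi> permutes {0..<n}
      \<and> (\<forall>k. 2 * k + 1 < n \<longrightarrow> \<pi> (2 * k) < \<pi> (2 * k + 1))
      \<and> (\<forall>k. 2 * k + 2 < n \<longrightarrow> \<pi> (2 * k) < \<pi> (2 * k + 2))} = matching_perms n"
    by (simp add: matching_perms_def atLeast0LessThan)
  then have "pfaffian A = (\<Sum>\<pi>\<in>matching_perms n.
      of_int (sign \<pi>) * (\<Prod>k<n div 2. A $$ (\<pi> (2 * k), \<pi> (Suc (2 * k)))))"
    by (simp add: pfaffian_def dim)
  also have "\<dots> = matching_sum M n"
    unfolding matching_sum_def matching_term_def
  proof (intro sum.cong refl arg_cong2[where f = times] prod.cong entries)
    fix \<pi> k assume "\<pi> \<in> matching_perms n" and k: "k \<in> {..<n div 2}"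
    then have "\<pi> permutes {..<n}"
      by (simp add: matching_perms_def)
    note in_image = permutes_in_image[OF this]
    show "\<pi> (2 * k) < n" "\<pi> (Suc (2 * k)) < n"
      using in_image[of "2 * k"] in_image[of "Suc (2 * k)"] k by auto
  qed
  finally show ?thesis .
qed

lemma matching_term_cong:
  assumes \<sigma>: "\<sigma> permutes {..<N}" and n: "n \<le> N"
    and eq: "\<And>i j. i < N \<Longrightarrow> j < N \<Longrightarrow> M i j = M' i j"
  shows "matching_term M n \<sigma> = matching_term M' n \<sigma>"
proof -
  have "\<sigma> i < N" if "i < n" for i
    using permutes_in_image[OF \<sigma>, of i] that n by simp
  then show ?thesis
    unfolding matching_term_def by (intro arg_cong2[where f = times] refl prod.cong eq) auto
qed

lemma pfaffian_border_even:
  fixes A :: "'a::field_char_0 mat"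
  assumes A: "A \<in> carrier_mat (d + 1) (d + 1)" and p: "p \<in> carrier_vec (d + 1)" and d: "even d"
    and skew: "\<And>i j. i \<le> d \<Longrightarrow> j \<le> d \<Longrightarrow> A $$ (i, j) = - A $$ (j, i)"
  shows "of_nat (card (hyperoctahedral d)) *
      pfaffian (four_block_mat A (mat_of_cols (d + 1) [p]) (mat_of_rows (d + 1) [- p]) (mat_of_rows_list 1 [[0]]))
    = (\<Sum>\<sigma> | \<sigma> permutes {..<Suc d}. matching_term (\<lambda>i j. A $$ (i, j)) d \<sigma> * p $ (\<sigma> d))"
proof -
  obtain m where m: "d = 2 * m"
    using d by (rule evenE)
  let ?B = "four_block_mat A (mat_of_cols (d + 1) [p]) (mat_of_rows (d + 1) [- p]) (mat_of_rows_list 1 [[0]])"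
  define M where "M i j = (if i \<le> d \<and> j \<le> d then A $$ (i, j)
      else if i \<le> d \<and> j = Suc d then p $ i else if i = Suc d \<and> j \<le> d then - p $ j else 0)" for i j
  have pf_B: "pfaffian ?B = matching_sum M (2 * Suc m)"
  proof (rule pfaffian_eq_matching_sum)
    fix i j assume "i < 2 * Suc m" "j < 2 * Suc m"
    then show "?B $$ (i, j) = M i j"
      using A p by (auto simp: M_def m mat_of_cols_index mat_of_rows_index mat_of_rows_list_def less_Suc_eq_le le_Suc_eq)
  qed (use A in \<open>auto simp: m mat_of_rows_list_def\<close>)
  have skew_M: "M i j = - M j i" for i j
    using skew[of i j] by (cases "i \<le> d"; cases "j \<le> d") (simp_all add: M_def)
  have "of_nat (card (hyperoctahedral d)) * pfaffian ?B
      = (\<Sum>\<sigma> | \<sigma> permutes {..<Suc d}. matching_term M d \<sigma> * M (\<sigma> d) (Suc d))"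
    unfolding pf_B using matching_sum_expand_last[where M = M, OF skew_M, of m] by (simp only: m)
  also have "\<dots> = (\<Sum>\<sigma> | \<sigma> permutes {..<Suc d}. matching_term (\<lambda>i j. A $$ (i, j)) d \<sigma> * p $ (\<sigma> d))"
  proof (rule sum.cong[OF refl])
    fix \<sigma> assume "\<sigma> \<in> {\<sigma>. \<sigma> permutes {..<Suc d}}"
    then have \<sigma>: "\<sigma> permutes {..<Suc d}" by simp
    then have "matching_term M d \<sigma> = matching_term (\<lambda>i j. A $$ (i, j)) d \<sigma>"
      by (rule matching_term_cong) (auto simp: M_def)
    moreover have "\<sigma> d \<le> d"
      using permutes_in_image[OF \<sigma>, of d] by simp
    ultimately show "matching_term M d \<sigma> * M (\<sigma> d) (Suc d) = matching_term (\<lambda>i j. A $$ (i, j)) d \<sigma> * p $ (\<sigma> d)"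
      by (simp add: M_def)
  qed
  finally show ?thesis .
qed

lemma pfaffian_border_odd:
  fixes A :: "'a::field_char_0 mat"
  assumes A: "A \<in> carrier_mat (d + 1) (d + 1)" and b: "b \<in> carrier_vec (d + 1)" and p: "p \<in> carrier_vec (d + 1)"
    and d: "odd d"
    and skew: "\<And>i j. i \<le> d \<Longrightarrow> j \<le> d \<Longrightarrow> A $$ (i, j) = - A $$ (j, i)"
  shows "of_nat (card (hyperoctahedral (d - 1))) *
      (pfaffian (four_block_mat A (mat_of_cols (d + 1) [b, p]) (mat_of_rows (d + 1) [- b, - p])
          (mat_of_rows_list 2 [[0, 1], [-1, 0]])) - pfaffian A)
    = - (\<Sum>\<sigma> | \<sigma> permutes {..<Suc d}.
          matching_term (\<lambda>i j. A $$ (i, j)) d \<sigma> * b $ (\<sigma> (d - 1)) * p $ (\<sigma> d))"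
proof -
  obtain q where q: "d = Suc (2 * q)"
    using d by (metis oddE Suc_eq_plus1)
  let ?B = "four_block_mat A (mat_of_cols (d + 1) [b, p]) (mat_of_rows (d + 1) [- b, - p])
          (mat_of_rows_list 2 [[0, 1], [-1, 0]])"
  let ?n = "2 * Suc q"
  define M where "M i j = (if i \<le> d \<and> j \<le> d then A $$ (i, j)
      else if i \<le> d \<and> j = ?n then b $ i else if i = ?n \<and> j \<le> d then - b $ j
      else if i \<le> d \<and> j = Suc ?n then p $ i else if i = Suc ?n \<and> j \<le> d then - p $ j
      else if i = ?n \<and> j = Suc ?n then 1 else if i = Suc ?n \<and> j = ?n then - 1 else 0)" for i j
  have pf_B: "pfaffian ?B = matching_sum M (2 * Suc (Suc q))"
  proof (rule pfaffian_eq_matching_sum)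
    fix i j assume "i < 2 * Suc (Suc q)" "j < 2 * Suc (Suc q)"
    then have "i \<le> d \<or> i = ?n \<or> i = Suc ?n" "j \<le> d \<or> j = ?n \<or> j = Suc ?n"
      by (auto simp: q)
    then show "?B $$ (i, j) = M i j"
      using A b p by (auto simp: M_def q mat_of_cols_index mat_of_rows_index mat_of_rows_list_def)
  qed (use A in \<open>auto simp: q mat_of_rows_list_def\<close>)
  have pf_A: "pfaffian A = matching_sum M ?n"
    by (rule pfaffian_eq_matching_sum) (use A in \<open>auto simp: M_def q\<close>)
  have skew_M: "M i j = - M j i" for i j
    using skew[of i j] by (cases "i \<le> d"; cases "j \<le> d") (simp_all add: M_def q)
  have M_corner: "M ?n (Suc ?n) = 1"
    by (simp add: M_def q)
  have "of_nat (card (hyperoctahedral (d - 1))) * (pfaffian ?B - pfaffian A)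
      = - (\<Sum>\<sigma> | \<sigma> permutes {..<?n}.
          matching_term M (2 * q) \<sigma> * M (\<sigma> (2 * q)) ?n * M (\<sigma> (Suc (2 * q))) (Suc ?n))"
    unfolding pf_B pf_A
    using matching_sum_expand_two_last[where M = M, OF skew_M refl, of q] by (simp only: M_corner q mult_1 diff_Suc_1)
  also have "(\<Sum>\<sigma> | \<sigma> permutes {..<?n}.
          matching_term M (2 * q) \<sigma> * M (\<sigma> (2 * q)) ?n * M (\<sigma> (Suc (2 * q))) (Suc ?n))
      = (\<Sum>\<sigma> | \<sigma> permutes {..<Suc d}.
          matching_term (\<lambda>i j. A $$ (i, j)) d \<sigma> * b $ (\<sigma> (d - 1)) * p $ (\<sigma> d))"
  proof (rule sum.cong)
    show "{\<sigma>. \<sigma> permutes {..<?n}} = {\<sigma>. \<sigma> permutes {..<Suc d}}"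
      by (simp add: q)
    fix \<sigma> assume "\<sigma> \<in> {\<sigma>. \<sigma> permutes {..<Suc d}}"
    then have \<sigma>: "\<sigma> permutes {..<Suc d}" by simp
    then have "matching_term M d \<sigma> = matching_term (\<lambda>i j. A $$ (i, j)) d \<sigma>"
      by (rule matching_term_cong) (auto simp: M_def)
    moreover have "matching_term M (2 * q) \<sigma> = matching_term M d \<sigma>"
      by (simp add: matching_term_def q)
    moreover have "\<sigma> (2 * q) \<le> d" "\<sigma> d \<le> d"
      using permutes_in_image[OF \<sigma>, of "2 * q"] permutes_in_image[OF \<sigma>, of d] by (auto simp: q)
    ultimately show "matching_term M (2 * q) \<sigma> * M (\<sigma> (2 * q)) ?n * M (\<sigma> (Suc (2 * q))) (Suc ?n)
        = matching_term (\<lambda>i j. A $$ (i, j)) d \<sigma> * b $ (\<sigma> (d - 1)) * p $ (\<sigma> d)"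
      by (simp add: M_def q)
  qed
  finally show ?thesis .
qed

text \<open>Both sides are compared after multiplication by the order of the hyperoctahedral group, a nonzero
natural number.\<close>

theorem theoremA1:
  fixes d :: nat
    and \<phi> :: "nat \<Rightarrow> real \<Rightarrow> 'a::{real_normed_field, banach, second_countable_topology}"
    and t :: real
  assumes "d \<ge> 1"
    and "\<And>i. i \<le> d \<Longrightarrow> integrable lebesgue (\<phi> i)"
  shows "ordered_det_integral d \<phi> t =
    (let A = pair_integral_mat d \<phi>; b = integral_vec d \<phi>; p = value_vec d \<phi> t in
     (-1) ^ d *
     (if even d then
        pfaffian (four_block_mat A (mat_of_cols (d + 1) [p])
                                 (mat_of_rows (d + 1) [- p]) (mat_of_rows_list 1 [[0]]))
      else
        pfaffian (four_block_mat A (mat_of_cols (d + 1) [b, p])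
                                 (mat_of_rows (d + 1) [- b, - p])
                                 (mat_of_rows_list 2 [[0, 1], [-1, 0]]))
        - pfaffian A))"
proof -
  have "\<exists>g. integrable lborel g \<and> (AE u in lborel. \<phi> i u = g u)" if "i \<le> d" for i
    using integrable_lebesgue_ex_integrable_lborel[OF assms(2)[OF that]] by metis
  then obtain \<psi> where \<psi>: "\<And>i. i \<le> d \<Longrightarrow> integrable lborel (\<psi> i)"
    and eq: "\<And>i. i \<le> d \<Longrightarrow> AE u in lborel. \<phi> i u = \<psi> i u"
    by metis
  define A where "A = pair_integral_mat d \<phi>"
  define b where "b = integral_vec d \<phi>"
  define p where "p = value_vec d \<phi> t"
  have A: "A \<in> carrier_mat (d + 1) (d + 1)" and b: "b \<in> carrier_vec (d + 1)" and p: "p \<in> carrier_vec (d + 1)"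
    by (simp_all add: A_def b_def p_def pair_integral_mat_def integral_vec_def value_vec_def carrier_vecI)
  have A_entry: "A $$ (i, j) = sign_pair_integral (\<psi> i) (\<psi> j)" if "i \<le> d" "j \<le> d" for i j
    unfolding A_def using \<psi> eq that by (rule pair_integral_mat_index)
  have skew: "A $$ (i, j) = - A $$ (j, i)" if "i \<le> d" "j \<le> d" for i j
    using sign_pair_integral_skew[OF \<psi> \<psi>] A_entry that by metis
  have b_entry: "b $ i = integral\<^sup>L lborel (\<psi> i)" if "i \<le> d" for i
    unfolding b_def using \<psi>[OF that] eq[OF that] that by (rule integral_vec_index)
  have p_entry: "p $ i = \<phi> i t" if "i \<le> d" for i
    using that by (simp add: p_def value_vec_def)
  let ?c = "of_nat (card (hyperoctahedral (2 * (d div 2)))) :: 'a"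
  have c: "?c \<noteq> 0"
    using card_hyperoctahedral_pos[of "2 * (d div 2)"] by simp
  have "?c * ordered_det_integral d \<phi> t
      = (\<Sum>\<sigma> | \<sigma> permutes {..<Suc d}. matching_term (\<lambda>i j. sign_pair_integral (\<psi> i) (\<psi> j)) d \<sigma>
          * (if odd d then integral\<^sup>L lborel (\<psi> (\<sigma> (d - 1))) else 1) * \<phi> (\<sigma> d) t)"
    using ordered_integral_alternating_sum[OF \<psi>, where c = "\<lambda>i. \<phi> i t"]
    by (simp only: ordered_det_integral_eq[OF \<psi> eq])
  also have "\<dots> = (\<Sum>\<sigma> | \<sigma> permutes {..<Suc d}. matching_term (\<lambda>i j. A $$ (i, j)) d \<sigma>
          * (if odd d then b $ (\<sigma> (d - 1)) else 1) * p $ (\<sigma> d))"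
  proof (rule sum.cong[OF refl])
    fix \<sigma> assume "\<sigma> \<in> {\<sigma>. \<sigma> permutes {..<Suc d}}"
    then have \<sigma>: "\<sigma> permutes {..<Suc d}" by simp
    then have "matching_term (\<lambda>i j. sign_pair_integral (\<psi> i) (\<psi> j)) d \<sigma> = matching_term (\<lambda>i j. A $$ (i, j)) d \<sigma>"
      by (rule matching_term_cong) (auto simp: A_entry)
    moreover have "\<sigma> (d - 1) \<le> d" "\<sigma> d \<le> d"
      using permutes_in_image[OF \<sigma>, of "d - 1"] permutes_in_image[OF \<sigma>, of d] by auto
    ultimately show "matching_term (\<lambda>i j. sign_pair_integral (\<psi> i) (\<psi> j)) d \<sigma>
          * (if odd d then integral\<^sup>L lborel (\<psi> (\<sigma> (d - 1))) else 1) * \<phi> (\<sigma> d) t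
        = matching_term (\<lambda>i j. A $$ (i, j)) d \<sigma> * (if odd d then b $ (\<sigma> (d - 1)) else 1) * p $ (\<sigma> d)"
      by (simp add: b_entry p_entry)
  qed
  finally have sum: "?c * ordered_det_integral d \<phi> t = \<dots>" .
  show ?thesis
  proof (cases "even d")
    case True
    then have "?c * ordered_det_integral d \<phi> t = ?c * pfaffian (four_block_mat A (mat_of_cols (d + 1) [p])
        (mat_of_rows (d + 1) [- p]) (mat_of_rows_list 1 [[0]]))"
      using sum pfaffian_border_even[OF A p True skew] by simp
    with c True show ?thesis
      by (simp add: A_def p_def Let_def)
  next
    case False
    then have "?c * ordered_det_integral d \<phi> t = ?c * - (pfaffian (four_block_mat A
        (mat_of_cols (d + 1) [b, p]) (mat_of_rows (d + 1) [- b, - p])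
        (mat_of_rows_list 2 [[0, 1], [-1, 0]])) - pfaffian A)"
      using sum pfaffian_border_odd[OF A b p False skew] False
      by (simp only: odd_two_times_div_two_nat if_True mult_minus_right minus_minus simp_thms)
    then have "ordered_det_integral d \<phi> t = - (pfaffian (four_block_mat A
        (mat_of_cols (d + 1) [b, p]) (mat_of_rows (d + 1) [- b, - p])
        (mat_of_rows_list 2 [[0, 1], [-1, 0]])) - pfaffian A)"
      using c by (subst (asm) mult_left_cancel)
    with False show ?thesis
      by (simp add: A_def b_def p_def Let_def)
  qed
qed

end
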